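(* Let $\mathbf{J}\sim\mathcal{N}(\mu,C)$ be the cost and let the stochastic errors $\epsilon_1,\epsilon_2,\dots$ be i.i.d. $\mathcal{N}(0,C_\epsilon)$. For batch size $b\in\mathbb{N}$ let $\mathcal{L}_b(w)=\mathbf{J}(w)+\frac1b\sum_{i=1}^b\epsilon_i(w)$. Then $$\operatorname*{argmin}_{\mathbf{d}}\ \mathbb{E}[\mathbf{J}(w-\mathbf{d})\mid\mathcal{L}_b(w),\nabla\mathcal{L}_b(w)]=\eta^*(\Theta)\,\frac{\nabla\mathcal{L}_b(w)}{\|\nabla\mathcal{L}_b(w)\|}$$ with the same step size function $\eta^*$ as for RFD, but with the modified $$\Theta=\frac{C'(0)}{C'(0)+\frac1bC_\epsilon'(0)}\cdot\frac{C(0)+\frac1bC_\epsilon(0)}{C(0)}\cdot\frac{\|\nabla\mathcal{L}_b(w)\|}{\mu-\mathcal{L}_b(w)}.$$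
   Context: $\mathbf{f}\sim\mathcal{N}(m,K)$ means that $\mathbf{f}$ is a Gaussian random function on $\mathbb{R}^d$ with $\mathbb{E}[\mathbf{f}(w)]=m$ and $\operatorname{Cov}(\mathbf{f}(w),\mathbf{f}(\tilde w))=K\bigl(\tfrac{\|w-\tilde w\|^2}{2}\bigr)$. The random functions $\mathbf{J},\epsilon_1,\epsilon_2,\dots$ are jointly Gaussian, and the $\epsilon_i$ are uncorrelated with (hence independent of) $\mathbf{J}$. All are differentiable with covariances of derivatives given by derivatives of the covariance functions; $C(0)>0$, $C'(0)<0$. The point $w$ is deterministic, $\mathcal{L}_b(w)<\mu$ and $\nabla\mathcal{L}_b(w)\neq0$. The RFD step size function is $$\eta^*(\Theta):=\operatorname*{argmin}_{\eta\in\mathbb{R}}\ -\frac{C(\eta^2/2)}{C(0)}-\eta\,\frac{C'(\eta^2/2)}{C'(0)}\,\Theta .$$ Minimizers are treated as existing and being unique. *)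

theory Defs
  imports "HOL-Probability.Probability"
begin

section \<open>Gaussian random functions\<close>

definition covariance :: "'o measure \<Rightarrow> ('o \<Rightarrow> real) \<Rightarrow> ('o \<Rightarrow> real) \<Rightarrow> real" where
  "covariance M X Y =
     (\<integral>\<omega>. (X \<omega> - (\<integral>\<omega>'. X \<omega>' \<partial>M)) * (Y \<omega> - (\<integral>\<omega>'. Y \<omega>' \<partial>M)) \<partial>M)"

text \<open>Normal laws include the degenerate ones (variance zero).\<close>

definition normal_rv :: "'o measure \<Rightarrow> ('o \<Rightarrow> real) \<Rightarrow> bool" where
  "normal_rv M X \<longleftrightarrow> X \<in> borel_measurable M \<and>
     ((\<exists>m. distr M borel X = return borel m) \<or>
      (\<exists>m s. s > 0 \<and> distr M borel X = density lborel (normal_density m s)))"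

definition gaussian_family :: "'o measure \<Rightarrow> ('i \<Rightarrow> 'o \<Rightarrow> real) \<Rightarrow> bool" where
  "gaussian_family M X \<longleftrightarrow>
     (\<forall>S a. finite S \<longrightarrow> normal_rv M (\<lambda>\<omega>. \<Sum>i\<in>S. a i * X i \<omega>))"

definition jointly_gaussian :: "'o measure \<Rightarrow> ('k \<Rightarrow> 'x \<Rightarrow> 'o \<Rightarrow> real) \<Rightarrow> bool" where
  "jointly_gaussian M F \<longleftrightarrow> gaussian_family M (\<lambda>(k, x). F k x)"

text \<open>The relation \<open>f \<sim> N(m, K)\<close>. Only the values of \<open>K\<close> on the nonnegative reals matter.\<close>

definition gaussian_random_function ::
  "'o measure \<Rightarrow> ('x::real_normed_vector \<Rightarrow> 'o \<Rightarrow> real) \<Rightarrow> real \<Rightarrow> (real \<Rightarrow> real) \<Rightarrow> bool" where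
  "gaussian_random_function M f m K \<longleftrightarrow>
     gaussian_family M f \<and>
     (\<forall>x. (\<integral>\<omega>. f x \<omega> \<partial>M) = m) \<and>
     (\<forall>x y. covariance M (f x) (f y) = K ((norm (x - y))\<^sup>2 / 2))"

section \<open>Derivatives of random functions\<close>

definition gradient :: "('x::real_inner \<Rightarrow> real) \<Rightarrow> 'x \<Rightarrow> 'x" where
  "gradient f x = (THE D. GDERIV f x :> D)"

definition random_gradient :: "('x::real_inner \<Rightarrow> 'o \<Rightarrow> real) \<Rightarrow> 'x \<Rightarrow> 'o \<Rightarrow> 'x" where
  "random_gradient f x \<omega> = gradient (\<lambda>y. f y \<omega>) x"

definition differentiable_random_function ::
  "'o measure \<Rightarrow> ('x::real_normed_vector \<Rightarrow> 'o \<Rightarrow> real) \<Rightarrow> bool" where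
  "differentiable_random_function M f \<longleftrightarrow>
     (\<forall>\<omega>\<in>space M. \<forall>x. (\<lambda>y. f y \<omega>) differentiable (at x))"

text \<open>Covariances of directional derivatives are directional derivatives of the covariance
  function: \<open>Cov(f(x), \<partial>\<^sub>v g(y)) = \<partial>\<^sub>v Cov(f(x), g(y))\<close>, the derivative being taken in \<open>y\<close>, and
  \<open>Cov(\<partial>\<^sub>u f(x), \<partial>\<^sub>v g(y)) = \<partial>\<^sub>u Cov(f(x), \<partial>\<^sub>v g(y))\<close>, the derivative being taken in \<open>x\<close>.\<close>

definition covariances_of_derivatives ::
  "'o measure \<Rightarrow> ('x::real_inner \<Rightarrow> 'o \<Rightarrow> real) \<Rightarrow> ('x \<Rightarrow> 'o \<Rightarrow> real) \<Rightarrow> bool" where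
  "covariances_of_derivatives M f g \<longleftrightarrow>
     (\<forall>x y v. ((\<lambda>t. covariance M (f x) (g (y + t *\<^sub>R v))) has_real_derivative
        covariance M (f x) (\<lambda>\<omega>. random_gradient g y \<omega> \<bullet> v)) (at 0)) \<and>
     (\<forall>x u y v. ((\<lambda>t. covariance M (f (x + t *\<^sub>R u)) (\<lambda>\<omega>. random_gradient g y \<omega> \<bullet> v))
        has_real_derivative
        covariance M (\<lambda>\<omega>. random_gradient f x \<omega> \<bullet> u) (\<lambda>\<omega>. random_gradient g y \<omega> \<bullet> v)) (at 0))"

section \<open>Batch loss and conditional expectation\<close>

definition batch_loss ::
  "('x \<Rightarrow> 'o \<Rightarrow> real) \<Rightarrow> (nat \<Rightarrow> 'x \<Rightarrow> 'o \<Rightarrow> real) \<Rightarrow> nat \<Rightarrow> 'x \<Rightarrow> 'o \<Rightarrow> real" where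
  "batch_loss J eps b x \<omega> = J x \<omega> + (1 / real b) * (\<Sum>i<b. eps i x \<omega>)"

text \<open>The sigma-algebra generated by \<open>f(w)\<close> and \<open>\<nabla>f(w)\<close>.\<close>

definition observation ::
  "'o measure \<Rightarrow> ('x::euclidean_space \<Rightarrow> 'o \<Rightarrow> real) \<Rightarrow> 'x \<Rightarrow> 'o measure" where
  "observation M f w =
     vimage_algebra (space M) (\<lambda>\<omega>. (f w \<omega>, random_gradient f w \<omega>)) borel"

text \<open>Each \<open>E[Y(d) | F]\<close> is determined only up to a null set depending on \<open>d\<close>. To minimize over
  the uncountably many \<open>d\<close> one fixes a version that is continuous in \<open>d\<close>; any two such versions
  agree for all \<open>d\<close> simultaneously, outside a single null set.\<close>

definition continuous_cond_exp ::
  "'o measure \<Rightarrow> 'o measure \<Rightarrow> ('x::topological_space \<Rightarrow> 'o \<Rightarrow> real) \<Rightarrow> ('x \<Rightarrow> 'o \<Rightarrow> real) \<Rightarrow> bool"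
  where
  "continuous_cond_exp M F Y Z \<longleftrightarrow>
     (\<forall>d. Z d \<in> borel_measurable F) \<and>
     (\<forall>d. AE \<omega> in M. Z d \<omega> = real_cond_exp M F (Y d) \<omega>) \<and>
     (\<forall>\<omega>\<in>space M. continuous_on UNIV (\<lambda>d. Z d \<omega>))"

section \<open>The RFD step size\<close>

text \<open>In what follows \<open>C'\<close> is the derivative of \<open>C\<close> on the nonnegative reals (one-sided at 0).\<close>

definition rfd_objective ::
  "(real \<Rightarrow> real) \<Rightarrow> (real \<Rightarrow> real) \<Rightarrow> real \<Rightarrow> real \<Rightarrow> real" where
  "rfd_objective C C' \<Theta> \<eta> = - (C (\<eta>\<^sup>2 / 2) / C 0) - \<eta> * (C' (\<eta>\<^sup>2 / 2) / C' 0) * \<Theta>"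

definition eta_star :: "(real \<Rightarrow> real) \<Rightarrow> (real \<Rightarrow> real) \<Rightarrow> real \<Rightarrow> real" where
  "eta_star C C' \<Theta> = arg_min (rfd_objective C C' \<Theta>) (\<lambda>_. True)"

end

theory Submission
  imports Defs
begin

text \<open>For jointly Gaussian variables the conditional expectation is the affine regression. Write
  \<open>L\<close> for the batch loss, \<open>K = C + C\<^sub>\<epsilon> / b\<close> for its kernel and \<open>G = \<nabla>L(w)\<close>. Differentiating the
  covariances gives \<open>Cov(L(w), G) = 0\<close>, \<open>Cov(G) = -K'(0) I\<close>,
  \<open>Cov(J(w - d), L(w)) = C(|d|\<^sup>2/2)\<close> and \<open>Cov(J(w - d), G) = C'(|d|\<^sup>2/2) d\<close>. Since the covariance
  matrix of \<open>(L(w), G)\<close> is diagonal, the regression is explicit: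
  \<open>E[J(w - d) | L(w), G] = \<mu> + C(|d|\<^sup>2/2) / K(0) (L(w) - \<mu>) - C'(|d|\<^sup>2/2) / K'(0) (d \<bullet> G)\<close>
  (\<open>cond_exp_given_value_and_gradient\<close>). For fixed \<open>|d|\<close> this is affine in \<open>d \<bullet> G\<close>, so that it is
  smallest where \<open>d\<close> is parallel to \<open>G\<close>; on that line it is, up to a positive affine map, the RFD
  objective with the modified \<open>\<Theta>\<close> (\<open>radial_arg_min\<close>, \<open>arg_min_cond_exp\<close>).

  Three points need analysis. First, the gradient has to be jointly Gaussian with the values: it is
  a pointwise limit of difference quotients with constant mean, and \<open>normal_rv_limit\<close> shows that
  normal laws survive such limits. Second, a residual that is uncorrelated with a jointly Gaussian
  vector has to have a constant conditional expectation (\<open>gaussian_cond_exp\<close>). The characteristic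
  function factorizes, and it remains to pass from exponentials to Borel sets in several dimensions;
  \<open>fourier_weight_borel\<close> does so one coordinate at a time, using Levy's uniqueness theorem on the
  real line. Third, \<open>C'\<close> is given only as a derivative, yet the regression must be continuous
  in \<open>d\<close>, and \<open>Cov(G)\<close> is a limit of values of \<open>K'\<close> near \<open>0\<close>. That the covariances of derivatives
  exist forces \<open>C'\<close> to be continuous (\<open>isotropic_kernel_derivative_continuous\<close>).\<close>

section \<open>Uniqueness for Fourier transforms of weighted laws\<close>

text \<open>The positive and the negative part of \<open>V\<close>, normalized to total mass one, push forward to two
  probability laws on the line with the same characteristic function. Levy's theorem identifies
  the laws, hence their integrals of any \<open>h\<close>.\<close>

lemma fourier_weight_real:
  fixes V X :: "'o \<Rightarrow> real" and h :: "real \<Rightarrow> real"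
  assumes V: "integrable M V" and X[measurable]: "X \<in> borel_measurable M"
    and h[measurable]: "h \<in> borel_measurable borel"
    and Vh: "integrable M (\<lambda>\<omega>. V \<omega> * h (X \<omega>))"
    and zero: "\<And>t. (\<integral>\<omega>. complex_of_real (V \<omega>) * iexp (t * X \<omega>) \<partial>M) = 0"
  shows "(\<integral>\<omega>. V \<omega> * h (X \<omega>) \<partial>M) = 0"
proof -
  have [measurable]: "V \<in> borel_measurable M" using V by simp
  define P N where "P \<omega> = max 0 (V \<omega>)" and "N \<omega> = max 0 (- V \<omega>)" for \<omega>
  have PN: "V \<omega> = P \<omega> - N \<omega>" "0 \<le> P \<omega>" "0 \<le> N \<omega>" "P \<omega> \<le> \<bar>V \<omega>\<bar>" "N \<omega> \<le> \<bar>V \<omega>\<bar>" for \<omega>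
    by (auto simp: P_def N_def)
  have [measurable]: "P \<in> borel_measurable M" "N \<in> borel_measurable M"
    unfolding P_def N_def by measurable
  have iP: "integrable M P" and iN: "integrable M N"
    by (rule Bochner_Integration.integrable_bound[OF V]; use PN in auto)+
  have bound: "integrable M (\<lambda>\<omega>. Q \<omega> * g (X \<omega>))"
    if "Q \<in> borel_measurable M" "\<And>\<omega>. 0 \<le> Q \<omega>" "\<And>\<omega>. Q \<omega> \<le> \<bar>V \<omega>\<bar>"
      "integrable M (\<lambda>\<omega>. V \<omega> * g (X \<omega>))" "g \<in> borel_measurable borel" for Q and g :: "real \<Rightarrow> real"
    by (rule Bochner_Integration.integrable_bound[OF that(4)])
       (use that in \<open>auto simp: abs_mult intro!: mult_right_mono\<close>)
  have cbound: "integrable M (\<lambda>\<omega>. complex_of_real (Q \<omega>) * iexp (t * X \<omega>))"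
    if "Q \<in> borel_measurable M" "\<And>\<omega>. 0 \<le> Q \<omega>" "\<And>\<omega>. Q \<omega> \<le> \<bar>V \<omega>\<bar>" for Q t
    by (rule Bochner_Integration.integrable_bound[OF V]) (use that in \<open>auto simp: norm_mult\<close>)
  define c where "c = (\<integral>\<omega>. P \<omega> \<partial>M)"
  have eq: "(\<integral>\<omega>. complex_of_real (P \<omega>) * iexp (t * X \<omega>) \<partial>M)
          = (\<integral>\<omega>. complex_of_real (N \<omega>) * iexp (t * X \<omega>) \<partial>M)" for t
  proof -
    have "0 = (\<integral>\<omega>. complex_of_real (P \<omega>) * iexp (t * X \<omega>)
                - complex_of_real (N \<omega>) * iexp (t * X \<omega>) \<partial>M)"
      using zero[of t] by (simp add: PN(1) left_diff_distrib)
    also have "\<dots> = (\<integral>\<omega>. complex_of_real (P \<omega>) * iexp (t * X \<omega>) \<partial>M)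
                - (\<integral>\<omega>. complex_of_real (N \<omega>) * iexp (t * X \<omega>) \<partial>M)"
      by (rule Bochner_Integration.integral_diff; rule cbound) (use PN in auto)
    finally show ?thesis by simp
  qed
  have cN: "c = (\<integral>\<omega>. N \<omega> \<partial>M)"
    using eq[of 0] by (simp add: c_def)
  have c0: "c \<ge> 0" unfolding c_def by (intro integral_nonneg_AE) (use PN in auto)
  \<comment> \<open>The normalization divides by \<open>c\<close>; if \<open>c = 0\<close> then \<open>V\<close> vanishes almost everywhere.\<close>
  show ?thesis
  proof (cases "c = 0")
    case True
    have "AE \<omega> in M. P \<omega> = 0"
      using True integral_nonneg_eq_0_iff_AE[OF iP] PN(2) by (simp add: c_def)
    moreover have "AE \<omega> in M. N \<omega> = 0"
      using True cN integral_nonneg_eq_0_iff_AE[OF iN] PN(3) by simp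
    ultimately have "AE \<omega> in M. V \<omega> * h (X \<omega>) = 0"
      by eventually_elim (simp add: PN(1))
    then show ?thesis by (simp add: integral_eq_zero_AE)
  next
    case False
    then have c: "c > 0" using c0 by simp
    define D where "D Q = distr (density M (\<lambda>\<omega>. ennreal (Q \<omega> / c))) borel X" for Q
    have prob: "real_distribution (D Q)"
      if [measurable]: "Q \<in> borel_measurable M" and "\<And>\<omega>. 0 \<le> Q \<omega>" "integrable M Q" "(\<integral>\<omega>. Q \<omega> \<partial>M) = c" for Q
    proof -
      have "(\<integral>\<^sup>+\<omega>. ennreal (Q \<omega> / c) \<partial>M) = ennreal (\<integral>\<omega>. Q \<omega> / c \<partial>M)"
        by (rule nn_integral_eq_integral) (use that c in auto)
      then have "prob_space (density M (\<lambda>\<omega>. ennreal (Q \<omega> / c)))"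
        using that c by (intro prob_spaceI) (simp add: emeasure_density)
      then show ?thesis unfolding D_def
        by (rule prob_space.real_distribution_distr) simp
    qed
    have int: "(\<integral>x. g x \<partial>D Q) = (\<integral>\<omega>. (Q \<omega> / c) *\<^sub>R g (X \<omega>) \<partial>M)"
      if [measurable]: "Q \<in> borel_measurable M" "g \<in> borel_measurable borel" and "\<And>\<omega>. 0 \<le> Q \<omega>"
      for Q and g :: "real \<Rightarrow> 'c::{banach, second_countable_topology}"
      unfolding D_def by (subst integral_distr, simp, simp, subst integral_density) (use that c in auto)
    have "char (D P) = char (D N)"
    proof
      fix t
      have "char (D Q) t = (\<integral>\<omega>. complex_of_real (Q \<omega>) * iexp (t * X \<omega>) \<partial>M) / c"
        if [measurable]: "Q \<in> borel_measurable M" and "\<And>\<omega>. 0 \<le> Q \<omega>" for Q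
        unfolding char_def using that by (subst int) (auto simp: scaleR_conv_of_real)
      then show "char (D P) t = char (D N) t" using eq[of t] PN by simp
    qed
    then have "D P = D N"
      by (intro Levy_uniqueness prob) (use PN iP iN cN in \<open>auto simp: c_def\<close>)
    then have "(\<integral>\<omega>. (P \<omega> / c) *\<^sub>R h (X \<omega>) \<partial>M) = (\<integral>\<omega>. (N \<omega> / c) *\<^sub>R h (X \<omega>) \<partial>M)"
      by (subst (1 2) int[symmetric]) (use PN in auto)
    then have "(\<integral>\<omega>. P \<omega> * h (X \<omega>) \<partial>M) = (\<integral>\<omega>. N \<omega> * h (X \<omega>) \<partial>M)"
      using c by simp
    moreover have "(\<integral>\<omega>. V \<omega> * h (X \<omega>) \<partial>M) = (\<integral>\<omega>. P \<omega> * h (X \<omega>) \<partial>M) - (\<integral>\<omega>. N \<omega> * h (X \<omega>) \<partial>M)"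
      unfolding PN(1) left_diff_distrib
      by (rule Bochner_Integration.integral_diff; rule bound) (use PN Vh in auto)
    ultimately show ?thesis by simp
  qed
qed

text \<open>The hypothesis holds for the conjugate of \<open>V\<close> as well (replace \<open>t\<close> by \<open>-t\<close> and conjugate), and
  so for the real and the imaginary part. Complex weights are what makes the induction below possible.\<close>

lemma fourier_weight:
  fixes V :: "'o \<Rightarrow> complex" and X :: "'o \<Rightarrow> real" and h :: "real \<Rightarrow> real"
  assumes V: "integrable M V" and X[measurable]: "X \<in> borel_measurable M"
    and h[measurable]: "h \<in> borel_measurable borel"
    and Vh: "integrable M (\<lambda>\<omega>. V \<omega> * of_real (h (X \<omega>)))"
    and zero: "\<And>t. (\<integral>\<omega>. V \<omega> * iexp (t * X \<omega>) \<partial>M) = 0"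
  shows "(\<integral>\<omega>. V \<omega> * of_real (h (X \<omega>)) \<partial>M) = 0"
proof -
  have [measurable]: "V \<in> borel_measurable M" using V by simp
  have int: "integrable M (\<lambda>\<omega>. V \<omega> * iexp (t * X \<omega>))" for t
    by (rule Bochner_Integration.integrable_bound[OF V]) (auto simp: norm_mult)
  have int': "integrable M (\<lambda>\<omega>. cnj (V \<omega>) * iexp (t * X \<omega>))" for t
    using integrable_cnj[OF int[of "- t"]] by (simp add: exp_cnj)
  have zero': "(\<integral>\<omega>. cnj (V \<omega>) * iexp (t * X \<omega>) \<partial>M) = 0" for t
  proof -
    have "(\<integral>\<omega>. cnj (V \<omega>) * iexp (t * X \<omega>) \<partial>M) = (\<integral>\<omega>. cnj (V \<omega> * iexp ((- t) * X \<omega>)) \<partial>M)"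
      by (simp add: exp_cnj)
    also have "\<dots> = cnj (\<integral>\<omega>. V \<omega> * iexp ((- t) * X \<omega>) \<partial>M)"
      by (rule Bochner_Integration.integral_cnj)
    also have "\<dots> = 0"
      by (simp only: zero complex_cnj_zero)
    finally show ?thesis .
  qed
  have re: "(\<integral>\<omega>. complex_of_real (Re (V \<omega>)) * iexp (t * X \<omega>) \<partial>M) = 0" for t
  proof -
    have e: "complex_of_real (Re (V \<omega>)) * iexp (t * X \<omega>)
        = (V \<omega> * iexp (t * X \<omega>) + cnj (V \<omega>) * iexp (t * X \<omega>)) / 2" for \<omega>
      by (simp add: complex_add_cnj flip: distrib_right)
    show ?thesis unfolding e using int[of t] int'[of t] zero[of t] zero'[of t] by simp
  qed
  have im: "(\<integral>\<omega>. complex_of_real (Im (V \<omega>)) * iexp (t * X \<omega>) \<partial>M) = 0" for t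
  proof -
    have e: "complex_of_real (Im (V \<omega>)) * iexp (t * X \<omega>)
        = (V \<omega> * iexp (t * X \<omega>) - cnj (V \<omega>) * iexp (t * X \<omega>)) / (2 * \<i>)" for \<omega>
    proof -
      have "complex_of_real (Im (V \<omega>)) = (V \<omega> - cnj (V \<omega>)) / (2 * \<i>)"
        by (simp add: complex_diff_cnj complex_eq_iff)
      then show ?thesis
        by (simp only: left_diff_distrib diff_divide_distrib times_divide_eq_left)
    qed
    show ?thesis unfolding e using int[of t] int'[of t] zero[of t] zero'[of t] by simp
  qed
  have iRe: "integrable M (\<lambda>\<omega>. Re (V \<omega>) * h (X \<omega>))" and iIm: "integrable M (\<lambda>\<omega>. Im (V \<omega>) * h (X \<omega>))"
    using integrable_Re[OF Vh] integrable_Im[OF Vh] by simp_all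
  have "(\<integral>\<omega>. Re (V \<omega>) * h (X \<omega>) \<partial>M) = 0" "(\<integral>\<omega>. Im (V \<omega>) * h (X \<omega>) \<partial>M) = 0"
    by (rule fourier_weight_real; use V re im iRe iIm in simp)+
  then show ?thesis
    using integral_Re[OF Vh] integral_Im[OF Vh] by (simp add: complex_eq_iff)
qed

text \<open>Exponentials are exchanged for indicators one coordinate at a time. For the coordinate \<open>j\<close> the
  exponentials of the other coordinates are absorbed into the weight, and afterwards the
  indicator of coordinate \<open>j\<close> joins the weight for the induction hypothesis.\<close>

lemma fourier_weight_indicators:
  fixes V :: "'o \<Rightarrow> complex" and X :: "'i \<Rightarrow> 'o \<Rightarrow> real"
  assumes "finite I" and "integrable M V" and "\<And>i. i \<in> I \<Longrightarrow> X i \<in> borel_measurable M"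
    and "\<And>i. i \<in> I \<Longrightarrow> A i \<in> sets borel"
    and "\<And>u. (\<integral>\<omega>. V \<omega> * (\<Prod>i\<in>I. iexp (u i * X i \<omega>)) \<partial>M) = 0"
  shows "(\<integral>\<omega>. V \<omega> * (\<Prod>i\<in>I. of_real (indicator (A i) (X i \<omega>))) \<partial>M) = 0"
  using assms
proof (induction I arbitrary: V rule: finite_induct)
  case empty
  then show ?case by simp
next
  case (insert j I)
  note [measurable] = insert.prems(2)[OF insertI1] insert.prems(3)[OF insertI1]
    and [measurable] = insert.prems(2)[OF insertI2]
  have [measurable]: "V \<in> borel_measurable M" using insert.prems(1) by simp
  let ?W = "\<lambda>\<omega>. V \<omega> * of_real (indicator (A j) (X j \<omega>))"
  have "(\<integral>\<omega>. ?W \<omega> * (\<Prod>i\<in>I. of_real (indicator (A i) (X i \<omega>))) \<partial>M) = 0"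
  proof (rule insert.IH)
    show "integrable M ?W"
      by (rule Bochner_Integration.integrable_bound[OF insert.prems(1)])
         (auto simp: norm_mult indicator_def)
    fix u :: "'i \<Rightarrow> real"
    have norm1: "norm (\<Prod>i\<in>I. iexp (u i * X i \<omega>)) = 1" for \<omega>
      by (simp add: prod_norm[symmetric])
    have "(\<integral>\<omega>. (V \<omega> * (\<Prod>i\<in>I. iexp (u i * X i \<omega>))) * of_real (indicator (A j) (X j \<omega>)) \<partial>M) = 0"
    proof (rule fourier_weight[where X = "X j"])
      show "integrable M (\<lambda>\<omega>. V \<omega> * (\<Prod>i\<in>I. iexp (u i * X i \<omega>)))"
        by (rule Bochner_Integration.integrable_bound[OF insert.prems(1)])
           (simp_all add: norm_mult norm1 del: of_real_mult)
      show "integrable M (\<lambda>\<omega>. V \<omega> * (\<Prod>i\<in>I. iexp (u i * X i \<omega>)) * of_real (indicator (A j) (X j \<omega>)))"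
        by (rule Bochner_Integration.integrable_bound[OF insert.prems(1)])
           (simp_all add: norm_mult norm1 indicator_def del: of_real_mult)
      fix t
      have e: "V \<omega> * (\<Prod>i\<in>I. iexp (u i * X i \<omega>)) * iexp (t * X j \<omega>)
          = V \<omega> * (\<Prod>i\<in>insert j I. iexp ((u(j := t)) i * X i \<omega>))" for \<omega>
      proof -
        have "(\<Prod>i\<in>I. iexp ((u(j := t)) i * X i \<omega>)) = (\<Prod>i\<in>I. iexp (u i * X i \<omega>))"
          using insert.hyps(2) by (intro prod.cong) auto
        then show ?thesis using insert.hyps by (simp add: mult_ac)
      qed
      show "(\<integral>\<omega>. V \<omega> * (\<Prod>i\<in>I. iexp (u i * X i \<omega>)) * iexp (t * X j \<omega>) \<partial>M) = 0"
        unfolding e by (rule insert.prems(4))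
    qed auto
    then show "(\<integral>\<omega>. ?W \<omega> * (\<Prod>i\<in>I. iexp (u i * X i \<omega>)) \<partial>M) = 0"
      by (simp add: mult_ac)
  qed (use insert.prems in auto)
  then show ?case using insert.hyps by (simp add: mult_ac)
qed

text \<open>Uniqueness of the Fourier transform of the signed measure with density \<open>V\<close>, pushed forward
  by \<open>X\<close>: it vanishes on boxes by the previous lemma, and boxes are an intersection-stable generator
  of the Borel sets.\<close>

lemma fourier_weight_borel:
  fixes V :: "'o \<Rightarrow> real" and X :: "'o \<Rightarrow> 'a::euclidean_space"
  assumes V: "integrable M V" and X[measurable]: "X \<in> borel_measurable M"
    and zero: "\<And>u. (\<integral>\<omega>. complex_of_real (V \<omega>) * iexp (X \<omega> \<bullet> u) \<partial>M) = 0"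
    and B: "B \<in> sets borel"
  shows "(\<integral>\<omega>. V \<omega> * indicator B (X \<omega>) \<partial>M) = 0"
proof -
  have [measurable]: "V \<in> borel_measurable M" using V by simp
  have int: "integrable M (\<lambda>\<omega>. Q \<omega> * indicator A (X \<omega>))"
    if [measurable]: "A \<in> sets borel" and "integrable M Q" for A and Q :: "'o \<Rightarrow> real"
    by (rule Bochner_Integration.integrable_bound[OF that(2)])
       (use that in \<open>auto simp: indicator_def\<close>)
  have box: "(\<integral>\<omega>. V \<omega> * indicator (box a b) (X \<omega>) \<partial>M) = 0" for a b
  proof -
    have "(\<integral>\<omega>. complex_of_real (V \<omega>) *
        (\<Prod>i\<in>Basis. of_real (indicator {a \<bullet> i<..<b \<bullet> i} (X \<omega> \<bullet> i))) \<partial>M) = 0"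
    proof (rule fourier_weight_indicators)
      fix u :: "'a \<Rightarrow> real"
      have "(\<Prod>i\<in>Basis. iexp (u i * (X \<omega> \<bullet> i))) = iexp (X \<omega> \<bullet> (\<Sum>i\<in>Basis. u i *\<^sub>R i))" for \<omega>
        by (simp add: exp_sum[symmetric] inner_sum_right sum_distrib_left)
      then show "(\<integral>\<omega>. complex_of_real (V \<omega>) * (\<Prod>i\<in>Basis. iexp (u i * (X \<omega> \<bullet> i))) \<partial>M) = 0"
        using zero by simp
    qed (use V in auto)
    moreover have "(\<Prod>i\<in>Basis. of_real (indicator {a \<bullet> i<..<b \<bullet> i} (x \<bullet> i)))
        = complex_of_real (indicator (box a b) x)" for x
      by (auto simp: indicator_def box_def)
    ultimately show ?thesis
      by (simp flip: of_real_mult)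
  qed
  define P N where "P \<omega> = max 0 (V \<omega>)" and "N \<omega> = max 0 (- V \<omega>)" for \<omega>
  have PN: "V \<omega> = P \<omega> - N \<omega>" "0 \<le> P \<omega>" "0 \<le> N \<omega>" "P \<omega> \<le> \<bar>V \<omega>\<bar>" "N \<omega> \<le> \<bar>V \<omega>\<bar>" for \<omega>
    by (auto simp: P_def N_def)
  have [measurable]: "P \<in> borel_measurable M" "N \<in> borel_measurable M"
    unfolding P_def N_def by measurable
  have iP: "integrable M P" and iN: "integrable M N"
    by (rule Bochner_Integration.integrable_bound[OF V]; use PN in auto)+
  define D where "D Q = distr (density M (\<lambda>\<omega>. ennreal (Q \<omega>))) borel X" for Q
  have em: "emeasure (D Q) A = ennreal (\<integral>\<omega>. Q \<omega> * indicator A (X \<omega>) \<partial>M)"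
    if [measurable]: "A \<in> sets borel" "Q \<in> borel_measurable M" and "integrable M Q" "\<And>\<omega>. 0 \<le> Q \<omega>" for A Q
  proof -
    have "emeasure (D Q) A = (\<integral>\<^sup>+\<omega>. ennreal (Q \<omega>) * indicator (X -` A \<inter> space M) \<omega> \<partial>M)"
      unfolding D_def by (simp add: emeasure_distr emeasure_density)
    also have "\<dots> = (\<integral>\<^sup>+\<omega>. ennreal (Q \<omega> * indicator A (X \<omega>)) \<partial>M)"
      by (intro nn_integral_cong) (auto simp: indicator_def)
    also have "\<dots> = ennreal (\<integral>\<omega>. Q \<omega> * indicator A (X \<omega>) \<partial>M)"
      by (rule nn_integral_eq_integral) (use that int in \<open>auto simp: indicator_def\<close>)
    finally show ?thesis .
  qed
  have diff: "(\<integral>\<omega>. V \<omega> * indicator A (X \<omega>) \<partial>M)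
      = (\<integral>\<omega>. P \<omega> * indicator A (X \<omega>) \<partial>M) - (\<integral>\<omega>. N \<omega> * indicator A (X \<omega>) \<partial>M)"
    if "A \<in> sets borel" for A
    unfolding PN(1) left_diff_distrib
    by (rule Bochner_Integration.integral_diff; rule int) (use that iP iN in auto)
  have "D P = D N"
  proof (rule measure_eqI_generator_eq)
    let ?E = "range (\<lambda>(a, b). box a b::'a set)"
    show "Int_stable ?E"
      by (auto simp: Int_stable_def box_Int_box)
    show "?E \<subseteq> Pow UNIV" "sets (D P) = sigma_sets UNIV ?E" "sets (D N) = sigma_sets UNIV ?E"
      by (simp_all add: D_def borel_eq_box)
    let ?A = "\<lambda>n::nat. box (- (real n *\<^sub>R One)) (real n *\<^sub>R One) :: 'a set"
    show "range ?A \<subseteq> ?E" "(\<Union>i. ?A i) = UNIV"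
      unfolding UN_box_eq_UNIV by auto
    show "emeasure (D P) (?A i) \<noteq> \<infinity>" for i
      using em[of "?A i" P] iP PN by simp
    show "emeasure (D P) A = emeasure (D N) A" if "A \<in> ?E" for A
      using that em[of A P] em[of A N] iP iN PN diff[of A] box by auto
  qed
  then have "ennreal (\<integral>\<omega>. P \<omega> * indicator B (X \<omega>) \<partial>M) = ennreal (\<integral>\<omega>. N \<omega> * indicator B (X \<omega>) \<partial>M)"
    using em[OF B, of P] em[OF B, of N] iP iN PN by simp
  then have "(\<integral>\<omega>. P \<omega> * indicator B (X \<omega>) \<partial>M) = (\<integral>\<omega>. N \<omega> * indicator B (X \<omega>) \<partial>M)"
    using PN by (subst (asm) ennreal_inj) (auto intro!: integral_nonneg_AE)
  then show ?thesis using diff[OF B] by simp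
qed

section \<open>Covariances\<close>

definition square_integrable :: "'o measure \<Rightarrow> ('o \<Rightarrow> real) \<Rightarrow> bool" where
  "square_integrable M X \<longleftrightarrow> X \<in> borel_measurable M \<and> integrable M (\<lambda>\<omega>. (X \<omega>)\<^sup>2)"

lemma square_integrable_mult:
  assumes "square_integrable M X" "square_integrable M Y"
  shows "integrable M (\<lambda>\<omega>. X \<omega> * Y \<omega>)"
proof (rule Bochner_Integration.integrable_bound)
  show "integrable M (\<lambda>\<omega>. (X \<omega>)\<^sup>2 + (Y \<omega>)\<^sup>2)"
    using assms by (auto simp: square_integrable_def)
  show "(\<lambda>\<omega>. X \<omega> * Y \<omega>) \<in> borel_measurable M"
    using assms by (auto simp: square_integrable_def)
  have "\<bar>x * y\<bar> \<le> x\<^sup>2 + y\<^sup>2" for x y :: real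
  proof -
    have "2 * (\<bar>x\<bar> * \<bar>y\<bar>) \<le> x\<^sup>2 + y\<^sup>2"
      using sum_squares_bound[of "\<bar>x\<bar>" "\<bar>y\<bar>"] by simp
    moreover have "0 \<le> \<bar>x\<bar> * \<bar>y\<bar>" by simp
    ultimately show ?thesis unfolding abs_mult by linarith
  qed
  then show "AE \<omega> in M. norm (X \<omega> * Y \<omega>) \<le> norm ((X \<omega>)\<^sup>2 + (Y \<omega>)\<^sup>2)"
    by auto
qed

lemma square_integrable_add:
  assumes "square_integrable M X" "square_integrable M Y"
  shows "square_integrable M (\<lambda>\<omega>. X \<omega> + Y \<omega>)"
  using assms square_integrable_mult[OF assms]
  by (auto simp: square_integrable_def power2_sum mult.assoc)

lemma square_integrable_scale:
  "square_integrable M X \<Longrightarrow> square_integrable M (\<lambda>\<omega>. c * X \<omega>)"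
  by (auto simp: square_integrable_def power_mult_distrib)

lemma square_integrable_sum:
  assumes "\<And>k. k \<in> A \<Longrightarrow> square_integrable M (X k)"
  shows "square_integrable M (\<lambda>\<omega>. \<Sum>k\<in>A. a k * X k \<omega>)"
  using assms
proof (induction A rule: infinite_finite_induct)
  case (insert k A)
  then show ?case by (simp add: square_integrable_add square_integrable_scale)
qed (auto simp: square_integrable_def)

lemma covariance_commute: "covariance M X Y = covariance M Y X"
  unfolding covariance_def by (simp add: mult.commute)

lemma covariance_cong:
  assumes "\<And>\<omega>. \<omega> \<in> space M \<Longrightarrow> X \<omega> = X' \<omega>" "\<And>\<omega>. \<omega> \<in> space M \<Longrightarrow> Y \<omega> = Y' \<omega>"
  shows "covariance M X Y = covariance M X' Y'"
proof -
  have "integral\<^sup>L M X = integral\<^sup>L M X'" "integral\<^sup>L M Y = integral\<^sup>L M Y'"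
    by (rule Bochner_Integration.integral_cong; use assms in simp)+
  then show ?thesis unfolding covariance_def
    by (intro Bochner_Integration.integral_cong) (use assms in auto)
qed

context prob_space
begin

lemma square_integrable_const: "square_integrable M (\<lambda>_. c)"
  by (simp add: square_integrable_def)

lemma square_integrable_integrable: "square_integrable M X \<Longrightarrow> integrable M X"
  using square_integrable_mult[of M X "\<lambda>_. 1"] square_integrable_const[of 1] by simp

lemma covariance_eq:
  assumes "square_integrable M X" "square_integrable M Y"
  shows "covariance M X Y = expectation (\<lambda>\<omega>. X \<omega> * Y \<omega>) - expectation X * expectation Y"
proof -
  note [simp] = square_integrable_mult[OF assms] assms[THEN square_integrable_integrable]
  show ?thesis
    unfolding covariance_def by (simp add: left_diff_distrib right_diff_distrib prob_space)
qed

lemma covariance_add_left: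
  assumes "square_integrable M X" "square_integrable M Y" "square_integrable M Z"
  shows "covariance M (\<lambda>\<omega>. X \<omega> + Y \<omega>) Z = covariance M X Z + covariance M Y Z"
proof -
  note [simp] = square_integrable_mult[OF assms(1,3)] square_integrable_mult[OF assms(2,3)]
    assms[THEN square_integrable_integrable]
  show ?thesis
    by (subst (1 2 3) covariance_eq) (auto intro: assms square_integrable_add simp: algebra_simps)
qed

lemma covariance_scale_left:
  assumes "square_integrable M X" "square_integrable M Z"
  shows "covariance M (\<lambda>\<omega>. c * X \<omega>) Z = c * covariance M X Z"
  by (subst (1 2) covariance_eq)
     (auto intro: assms square_integrable_scale simp: algebra_simps)

lemma covariance_sum_left:
  assumes "finite A" "\<And>k. k \<in> A \<Longrightarrow> square_integrable M (X k)" "square_integrable M Z"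
  shows "covariance M (\<lambda>\<omega>. \<Sum>k\<in>A. a k * X k \<omega>) Z = (\<Sum>k\<in>A. a k * covariance M (X k) Z)"
  using assms
proof (induction A rule: finite_induct)
  case empty
  then show ?case by (simp add: covariance_def)
next
  case (insert k A)
  then show ?case
    by (simp add: covariance_add_left covariance_scale_left square_integrable_scale square_integrable_sum)
qed

lemma covariance_add_right:
  assumes "square_integrable M X" "square_integrable M Y" "square_integrable M Z"
  shows "covariance M Z (\<lambda>\<omega>. X \<omega> + Y \<omega>) = covariance M Z X + covariance M Z Y"
  using covariance_add_left[OF assms] by (simp add: covariance_commute)

lemma covariance_sum_right:
  assumes "finite A" "\<And>k. k \<in> A \<Longrightarrow> square_integrable M (X k)" "square_integrable M Z"
  shows "covariance M Z (\<lambda>\<omega>. \<Sum>k\<in>A. a k * X k \<omega>) = (\<Sum>k\<in>A. a k * covariance M Z (X k))"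
  using covariance_sum_left[OF assms, where a = a] by (simp add: covariance_commute)

lemma covariance_sum:
  assumes "finite A" "\<And>k. k \<in> A \<Longrightarrow> square_integrable M (X k)"
    and "finite B" "\<And>l. l \<in> B \<Longrightarrow> square_integrable M (Y l)"
  shows "covariance M (\<lambda>\<omega>. \<Sum>k\<in>A. a k * X k \<omega>) (\<lambda>\<omega>. \<Sum>l\<in>B. b l * Y l \<omega>)
    = (\<Sum>k\<in>A. \<Sum>l\<in>B. a k * b l * covariance M (X k) (Y l))"
proof -
  have "covariance M (X k) (\<lambda>\<omega>. \<Sum>l\<in>B. b l * Y l \<omega>) = (\<Sum>l\<in>B. b l * covariance M (X k) (Y l))"
    if "k \<in> A" for k
    by (rule covariance_sum_right) (use assms that in auto)
  then show ?thesis
    by (subst covariance_sum_left)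
       (auto intro: assms square_integrable_sum simp: sum_distrib_left mult.assoc)
qed

end

section \<open>Gaussian random variables\<close>

text \<open>Reduction to the standard normal law by the substitution \<open>(x - m) / s\<close>.\<close>

lemma char_normal_density:
  assumes s: "s > 0"
  shows "char (density lborel (normal_density m s)) t
    = iexp (t * m) * complex_of_real (exp (- (s\<^sup>2 * t\<^sup>2) / 2))"
proof -
  let ?N = "density lborel (normal_density m s)"
  interpret N: prob_space ?N by (rule prob_space_normal_density[OF s])
  have "distributed ?N lborel (\<lambda>x. x) (normal_density m s)"
    by (auto simp: distributed_def intro!: distr_id2)
  then have "distributed ?N lborel (\<lambda>x. (x - m) / s) std_normal_density"
    using N.normal_standard_normal_convert[OF s, of "\<lambda>x. x" m] by simp
  then have d: "distr ?N lborel (\<lambda>x. (x - m) / s) = std_normal_distribution"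
    by (auto simp: distributed_def)
  have "complex_of_real (exp (- ((s * t)\<^sup>2) / 2))
      = (\<integral>x. iexp (s * t * x) \<partial>distr ?N lborel (\<lambda>x. (x - m) / s))"
    unfolding d char_def[symmetric] by (simp add: char_std_normal_distribution)
  also have "\<dots> = (\<integral>x. iexp (s * t * ((x - m) / s)) \<partial>?N)"
    by (rule integral_distr) auto
  also have "\<dots> = (\<integral>x. iexp (- (t * m)) * iexp (t * x) \<partial>?N)"
  proof (rule Bochner_Integration.integral_cong[OF refl])
    fix x
    have "s * t * ((x - m) / s) = - (t * m) + t * x"
      using s by (simp add: field_simps)
    then show "iexp (s * t * ((x - m) / s)) = iexp (- (t * m)) * iexp (t * x)"
      by (simp only: of_real_add distrib_left exp_add)
  qed
  also have "\<dots> = iexp (- (t * m)) * char ?N t"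
    unfolding char_def by (rule integral_mult_right_zero)
  finally have "iexp (t * m) * complex_of_real (exp (- ((s * t)\<^sup>2) / 2))
      = (iexp (t * m) * iexp (- (t * m))) * char ?N t"
    by (simp only: mult.assoc)
  also have "iexp (t * m) * iexp (- (t * m)) = 1"
    by (simp flip: exp_add)
  finally show ?thesis by (simp add: power_mult_distrib)
qed

context prob_space
begin

lemma dirac_law:
  assumes X[measurable]: "X \<in> borel_measurable M" and d: "distr M borel X = return borel m"
  shows "integrable M (\<lambda>\<omega>. (X \<omega>)\<^sup>2)" "expectation X = m" "covariance M X X = 0"
proof -
  have "AE x in distr M borel X. x = m"
    unfolding d by (subst AE_return) auto
  then have ae: "AE \<omega> in M. X \<omega> = m"
    by (subst (asm) AE_distr_iff) auto
  show "integrable M (\<lambda>\<omega>. (X \<omega>)\<^sup>2)"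
    by (rule integrable_cong_AE_imp[where g = "\<lambda>_. m\<^sup>2"]) (use ae in auto)
  have "expectation X = expectation (\<lambda>_. m)"
    by (rule integral_cong_AE) (use ae in auto)
  then show e: "expectation X = m" by (simp add: prob_space)
  have "covariance M X X = expectation (\<lambda>_. 0)"
    unfolding covariance_def e by (rule integral_cong_AE) (use ae in auto)
  then show "covariance M X X = 0" by simp
qed

lemma normal_law:
  assumes X[measurable]: "X \<in> borel_measurable M" and s: "s > 0"
    and d: "distr M borel X = density lborel (normal_density m s)"
  shows "integrable M (\<lambda>\<omega>. (X \<omega>)\<^sup>2)" "expectation X = m" "covariance M X X = s\<^sup>2"
proof -
  have "distr M lborel X = distr M borel X" by (rule distr_cong) auto
  then have D: "distributed M lborel X (normal_density m s)"
    by (auto simp: distributed_def d)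
  show e: "expectation X = m" by (rule normal_distributed_expectation[OF s D])
  have i: "integrable M (\<lambda>\<omega>. (X \<omega> - m) ^ k)" for k
    using integrable_normal_moment[OF s] distributed_integrable[OF D, of "\<lambda>x. (x - m) ^ k"] by simp
  have "(X \<omega>)\<^sup>2 = (X \<omega> - m)^2 + 2 * m * (X \<omega> - m)^1 + m\<^sup>2" for \<omega>
    by (simp add: power2_eq_square algebra_simps)
  then show "integrable M (\<lambda>\<omega>. (X \<omega>)\<^sup>2)"
    by (simp only:) (intro Bochner_Integration.integrable_add integrable_mult_right i integrable_const)
  show "covariance M X X = s\<^sup>2"
    using normal_distributed_variance[OF s D]
    by (simp add: covariance_def e power2_eq_square)
qed

lemma normal_rv_square_integrable:
  assumes "normal_rv M X"
  shows "square_integrable M X"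
  using assms dirac_law(1) normal_law(1) by (auto simp: normal_rv_def square_integrable_def)

lemma covariance_self_nonneg: "covariance M X X \<ge> 0"
  unfolding covariance_def by (rule integral_nonneg_AE) auto

lemma normal_rv_char:
  assumes "normal_rv M X"
  shows "char (distr M borel X) t
    = iexp (t * expectation X) * complex_of_real (exp (- (covariance M X X * t\<^sup>2) / 2))"
proof -
  have X: "X \<in> borel_measurable M" using assms by (simp add: normal_rv_def)
  consider m where "distr M borel X = return borel m"
    | m s where "s > 0" "distr M borel X = density lborel (normal_density m s)"
    using assms by (auto simp: normal_rv_def)
  then show ?thesis
  proof cases
    case 1
    then have "char (distr M borel X) t = iexp (t * m)"
      by (simp add: char_def integral_return)
    then show ?thesis using dirac_law[OF X 1] by simp
  next
    case 2
    then show ?thesis using normal_law[OF X 2] char_normal_density[OF 2(1)] by simp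
  qed
qed

lemma normal_rv_expectation_iexp:
  assumes "normal_rv M X"
  shows "(\<integral>\<omega>. iexp (X \<omega>) \<partial>M) = iexp (expectation X) * complex_of_real (exp (- covariance M X X / 2))"
proof -
  have "X \<in> borel_measurable M" using assms by (simp add: normal_rv_def)
  then have "char (distr M borel X) 1 = (\<integral>\<omega>. iexp (X \<omega>) \<partial>M)"
    by (simp add: char_def integral_distr)
  then show ?thesis using normal_rv_char[OF assms, of 1] by simp
qed

text \<open>The case \<open>v = 0\<close> has to be treated apart, because there the law is a point mass.\<close>

lemma normal_rv_if_char:
  assumes X[measurable]: "X \<in> borel_measurable M" and v: "v \<ge> 0"
    and c: "\<And>t. char (distr M borel X) t = iexp (t * m) * complex_of_real (exp (- (v * t\<^sup>2) / 2))"
  shows "normal_rv M X" "expectation X = m"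
proof -
  have "normal_rv M X \<and> expectation X = m"
  proof (cases "v = 0")
    case True
    have "real_distribution (return borel m)"
      unfolding real_distribution_def real_distribution_axioms_def
      by (auto intro: prob_space_return)
    moreover have "char (return borel m) t = iexp (t * m)" for t
      by (simp add: char_def integral_return)
    ultimately have "distr M borel X = return borel m"
      using True c by (intro Levy_uniqueness) (auto simp: fun_eq_iff)
    then show ?thesis using dirac_law[OF X] by (auto simp: normal_rv_def)
  next
    case False
    define s where "s = sqrt v"
    have s: "s > 0" "s\<^sup>2 = v" using False v by (auto simp: s_def)
    have "real_distribution (density lborel (normal_density m s))"
      unfolding real_distribution_def real_distribution_axioms_def
      using prob_space_normal_density[OF s(1)] by auto
    then have "distr M borel X = density lborel (normal_density m s)"
      using c by (intro Levy_uniqueness) (auto simp: fun_eq_iff char_normal_density[OF s(1)] s(2))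
    then show ?thesis using normal_law[OF X s(1)] s X by (auto simp: normal_rv_def)
  qed
  then show "normal_rv M X" "expectation X = m" by auto
qed

text \<open>By dominated convergence the characteristic functions converge pointwise. Their moduli
  \<open>exp(-v\<^sub>n t\<^sup>2/2)\<close> converge to a function that is continuous and equal to \<open>1\<close> at \<open>0\<close>, so the limit is
  positive at some \<open>t\<^sub>0 > 0\<close>; taking logarithms there shows that the variances \<open>v\<^sub>n\<close> converge. As
  the means are constant, the limit has the characteristic function of a normal law.\<close>

lemma normal_rv_limit:
  assumes X: "\<And>n. normal_rv M (X n)" and m: "\<And>n. expectation (X n) = m"
    and lim: "\<And>\<omega>. \<omega> \<in> space M \<Longrightarrow> (\<lambda>n. X n \<omega>) \<longlonglongrightarrow> Y \<omega>"
  shows "normal_rv M Y" "expectation Y = m"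
proof -
  have [measurable]: "X n \<in> borel_measurable M" for n using X by (simp add: normal_rv_def)
  have Y[measurable]: "Y \<in> borel_measurable M"
    by (rule borel_measurable_LIMSEQ_real[OF lim]) auto
  interpret Y: real_distribution "distr M borel Y" by simp
  let ?c = "char (distr M borel Y)"
  define v where "v n = covariance M (X n) (X n)" for n
  have v0: "v n \<ge> 0" for n unfolding v_def by (rule covariance_self_nonneg)
  have cX: "char (distr M borel (X n)) t = iexp (t * m) * complex_of_real (exp (- (v n * t\<^sup>2) / 2))" for n t
    using normal_rv_char[OF X] m by (simp add: v_def)
  have conv: "(\<lambda>n. char (distr M borel (X n)) t) \<longlonglongrightarrow> ?c t" for t
  proof -
    have "(\<lambda>n. \<integral>\<omega>. iexp (t * X n \<omega>) \<partial>M) \<longlonglongrightarrow> (\<integral>\<omega>. iexp (t * Y \<omega>) \<partial>M)"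
      by (rule integral_dominated_convergence[where w = "\<lambda>_. 1"])
         (auto intro!: tendsto_intros lim)
    then show ?thesis by (simp add: char_def integral_distr)
  qed
  have nconv: "(\<lambda>n. exp (- (v n * t\<^sup>2) / 2)) \<longlonglongrightarrow> norm (?c t)" for t
    using tendsto_norm[OF conv[of t]] by (simp add: cX norm_mult)
  have "isCont (\<lambda>t. norm (?c t)) 0"
    by (intro continuous_intros Y.isCont_char)
  then have "((\<lambda>t. norm (?c t)) \<longlongrightarrow> 1) (at 0)"
    by (simp add: isCont_def Y.char_zero)
  then have "eventually (\<lambda>t. norm (?c t) > 0) (at 0)"
    by (rule order_tendstoD) simp
  then obtain d where d: "d > 0" "\<And>t. t \<noteq> 0 \<Longrightarrow> \<bar>t\<bar> < d \<Longrightarrow> norm (?c t) > 0"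
    by (auto simp: eventually_at dist_real_def)
  define t0 where "t0 = d / 2"
  have t0: "t0 > 0" "norm (?c t0) > 0" using d by (auto simp: t0_def)
  have "(\<lambda>n. ln (exp (- (v n * t0\<^sup>2) / 2))) \<longlonglongrightarrow> ln (norm (?c t0))"
    by (rule tendsto_ln[OF nconv]) (use t0 in auto)
  then have "(\<lambda>n. (- 2 / t0\<^sup>2) * (- (v n * t0\<^sup>2) / 2)) \<longlonglongrightarrow> (- 2 / t0\<^sup>2) * ln (norm (?c t0))"
    unfolding ln_exp by (rule tendsto_mult_left)
  moreover have "(- 2 / t0\<^sup>2) * (- (v n * t0\<^sup>2) / 2) = v n" for n
    using t0 by (simp add: field_simps)
  ultimately obtain w where w: "v \<longlonglongrightarrow> w" by auto
  have w0: "w \<ge> 0" by (rule LIMSEQ_le_const[OF w]) (use v0 in auto)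
  have c: "?c t = iexp (t * m) * complex_of_real (exp (- (w * t\<^sup>2) / 2))" for t
  proof (rule LIMSEQ_unique[OF conv])
    show "(\<lambda>n. char (distr M borel (X n)) t)
        \<longlonglongrightarrow> iexp (t * m) * complex_of_real (exp (- (w * t\<^sup>2) / 2))"
      unfolding cX by (intro tendsto_intros w) auto
  qed
  show "normal_rv M Y" "expectation Y = m"
    using normal_rv_if_char[OF Y w0 c] by auto
qed

end

section \<open>Conditioning on an uncorrelated Gaussian vector\<close>

context prob_space
begin

text \<open>For \<open>S = X \<bullet> u\<close> the characteristic function of \<open>tR + S\<close> factorizes, that is, the weight
  \<open>exp(iS) - E exp(iS)\<close> is orthogonal to all \<open>exp(itR)\<close>. It is then orthogonal to \<open>R\<close> itself,
  so \<open>R - E R\<close> is orthogonal to all \<open>exp(iX \<bullet> u)\<close>, hence to all indicators of events in \<open>X\<close>.\<close>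

lemma gaussian_uncorrelated_weight:
  fixes X :: "'a \<Rightarrow> 'b::euclidean_space"
  assumes X[measurable]: "X \<in> borel_measurable M"
    and normal: "\<And>t u. normal_rv M (\<lambda>\<omega>. t * R \<omega> + X \<omega> \<bullet> u)"
    and uncorr: "\<And>u. covariance M R (\<lambda>\<omega>. X \<omega> \<bullet> u) = 0"
    and B: "B \<in> sets borel"
  shows "(\<integral>\<omega>. (R \<omega> - expectation R) * indicator B (X \<omega>) \<partial>M) = 0"
proof -
  have nR: "normal_rv M (\<lambda>\<omega>. t * R \<omega>)" for t using normal[of t 0] by simp
  have nS: "normal_rv M (\<lambda>\<omega>. X \<omega> \<bullet> u)" for u using normal[of 0 u] by simp
  have sR: "square_integrable M R"
    using nR[of 1] by (simp add: normal_rv_square_integrable)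
  have sS: "square_integrable M (\<lambda>\<omega>. X \<omega> \<bullet> u)" for u
    using nS by (simp add: normal_rv_square_integrable)
  note iR[simp] = square_integrable_integrable[OF sR] and iS[simp] = square_integrable_integrable[OF sS]
  have [measurable]: "R \<in> borel_measurable M" using sR by (simp add: square_integrable_def)
  have iR1: "integrable M (\<lambda>\<omega>. R \<omega> - expectation R)" by simp
  show ?thesis
  proof (rule fourier_weight_borel[OF iR1 X _ B])
    fix u
    let ?S = "\<lambda>\<omega>. X \<omega> \<bullet> u"
    define c where "c = (\<integral>\<omega>. iexp (?S \<omega>) \<partial>M)"
    have iexp_int: "integrable M (\<lambda>\<omega>. iexp (Z \<omega>))" if "Z \<in> borel_measurable M" for Z
      using that by (intro integrable_const_bound[where B = 1]) auto
    have iRe: "integrable M (\<lambda>\<omega>. iexp (?S \<omega>) * complex_of_real (R \<omega>))"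
      by (rule Bochner_Integration.integrable_bound[OF iR]) (auto simp: norm_mult)
    have factor: "(\<integral>\<omega>. iexp (t * R \<omega> + ?S \<omega>) \<partial>M) = c * (\<integral>\<omega>. iexp (t * R \<omega>) \<partial>M)" for t
    proof -
      have e: "expectation (\<lambda>\<omega>. t * R \<omega> + ?S \<omega>) = expectation (\<lambda>\<omega>. t * R \<omega>) + expectation ?S"
        by simp
      have "covariance M (\<lambda>\<omega>. t * R \<omega> + ?S \<omega>) (\<lambda>\<omega>. t * R \<omega> + ?S \<omega>)
          = covariance M (\<lambda>\<omega>. t * R \<omega>) (\<lambda>\<omega>. t * R \<omega>) + covariance M ?S ?S"
      proof -
        have sR': "square_integrable M (\<lambda>\<omega>. t * R \<omega>)" using sR by (rule square_integrable_scale)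
        have 0: "covariance M (\<lambda>\<omega>. t * R \<omega>) ?S = 0"
          using covariance_scale_left[OF sR sS[of u], of t] uncorr[of u] by simp
        have "covariance M ?S (\<lambda>\<omega>. t * R \<omega>) = 0"
          unfolding covariance_commute[of M ?S] by (rule 0)
        then show ?thesis
          using sR' sS[of u] 0
          by (simp add: covariance_add_left covariance_add_right square_integrable_add)
      qed
      then have "(\<integral>\<omega>. iexp (t * R \<omega> + ?S \<omega>) \<partial>M)
          = iexp (expectation (\<lambda>\<omega>. t * R \<omega>) + expectation ?S)
            * complex_of_real (exp (- (covariance M (\<lambda>\<omega>. t * R \<omega>) (\<lambda>\<omega>. t * R \<omega>) + covariance M ?S ?S) / 2))"
        by (simp only: normal_rv_expectation_iexp[OF normal] e)
      moreover have "complex_of_real (exp (- (v + w) / 2))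
          = complex_of_real (exp (- v / 2)) * complex_of_real (exp (- w / 2))" for v w
        by (simp add: exp_add[symmetric] add_divide_distrib flip: of_real_mult)
      ultimately show ?thesis
        unfolding c_def normal_rv_expectation_iexp[OF nS] normal_rv_expectation_iexp[OF nR]
        by (simp only: of_real_add distrib_left exp_add mult_ac)
    qed
    have "(\<integral>\<omega>. (iexp (?S \<omega>) - c) * complex_of_real (R \<omega>) \<partial>M) = 0"
    proof (rule fourier_weight[where h = "\<lambda>x. x"])
      show "integrable M (\<lambda>\<omega>. iexp (?S \<omega>) - c)"
        by (intro Bochner_Integration.integrable_diff iexp_int) auto
      show "integrable M (\<lambda>\<omega>. (iexp (?S \<omega>) - c) * complex_of_real (R \<omega>))"
        unfolding left_diff_distrib
        by (intro Bochner_Integration.integrable_diff iRe) auto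
      fix t
      have "(iexp (?S \<omega>) - c) * iexp (t * R \<omega>) = iexp (t * R \<omega> + ?S \<omega>) - c * iexp (t * R \<omega>)" for \<omega>
        by (simp only: of_real_add distrib_left exp_add left_diff_distrib) (simp only: mult.commute)
      then have "(\<integral>\<omega>. (iexp (?S \<omega>) - c) * iexp (t * R \<omega>) \<partial>M)
          = (\<integral>\<omega>. iexp (t * R \<omega> + ?S \<omega>) - c * iexp (t * R \<omega>) \<partial>M)"
        by (simp only:)
      also have "\<dots> = (\<integral>\<omega>. iexp (t * R \<omega> + ?S \<omega>) \<partial>M) - (\<integral>\<omega>. c * iexp (t * R \<omega>) \<partial>M)"
        by (intro Bochner_Integration.integral_diff integrable_mult_right iexp_int) measurable
      also have "\<dots> = 0"
        unfolding factor by simp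
      finally show "(\<integral>\<omega>. (iexp (?S \<omega>) - c) * iexp (t * R \<omega>) \<partial>M) = 0" .
    qed auto
    then have "(\<integral>\<omega>. iexp (?S \<omega>) * complex_of_real (R \<omega>) \<partial>M) = c * complex_of_real (expectation R)"
      unfolding left_diff_distrib using iRe by simp
    moreover have "complex_of_real (R \<omega> - expectation R) * iexp (?S \<omega>)
        = iexp (?S \<omega>) * complex_of_real (R \<omega>) - complex_of_real (expectation R) * iexp (?S \<omega>)" for \<omega>
      by (simp add: algebra_simps)
    ultimately show "(\<integral>\<omega>. complex_of_real (R \<omega> - expectation R) * iexp (?S \<omega>) \<partial>M) = 0"
      using iRe iexp_int[of ?S] by (simp add: c_def)
  qed
qed

text \<open>The residual \<open>R\<close> enters uncentred and its mean is added back: a centred residual would put a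
  constant into the linear combinations, which joint Gaussianity does not speak of.\<close>

lemma gaussian_cond_exp:
  fixes X :: "'a \<Rightarrow> 'b::euclidean_space" and h :: "'b \<Rightarrow> real"
  assumes X[measurable]: "X \<in> borel_measurable M"
    and normal: "\<And>t u. normal_rv M (\<lambda>\<omega>. t * R \<omega> + X \<omega> \<bullet> u)"
    and uncorr: "\<And>u. covariance M R (\<lambda>\<omega>. X \<omega> \<bullet> u) = 0"
    and h[measurable]: "h \<in> borel_measurable borel" and ih: "integrable M (\<lambda>\<omega>. h (X \<omega>))"
  shows "AE \<omega> in M. real_cond_exp M (vimage_algebra (space M) X borel) (\<lambda>\<omega>. h (X \<omega>) + R \<omega>) \<omega>
    = h (X \<omega>) + expectation R"
proof -
  let ?F = "vimage_algebra (space M) X borel"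
  have sub: "subalgebra M ?F"
    by (auto simp: subalgebra_def sets_vimage_algebra2 measurable_sets[OF X])
  interpret finite_measure_subalgebra M ?F
    by unfold_locales (rule sub)
  have XF[measurable]: "X \<in> borel_measurable ?F"
    by (rule measurable_vimage_algebra1) auto
  have iR[simp]: "integrable M R"
    using normal[of 1 0] by (simp add: normal_rv_square_integrable square_integrable_integrable)
  show ?thesis
  proof (rule real_cond_exp_charact)
    fix A assume "A \<in> sets ?F"
    then obtain B where B[measurable]: "B \<in> sets borel" and A: "A = X -` B \<inter> space M"
      by (auto simp: sets_vimage_algebra2)
    have [measurable]: "A \<in> sets M" unfolding A by simp
    have ind: "indicator A \<omega> = (indicator B (X \<omega>) :: real)" if "\<omega> \<in> space M" for \<omega>
      using that by (auto simp: A indicator_def)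
    have "(\<integral>\<omega>. indicator A \<omega> * (R \<omega> - expectation R) \<partial>M)
        = (\<integral>\<omega>. (R \<omega> - expectation R) * indicator B (X \<omega>) \<partial>M)"
      by (rule Bochner_Integration.integral_cong) (auto simp: ind)
    also have "\<dots> = 0"
      by (rule gaussian_uncorrelated_weight[OF X normal uncorr B])
    finally have 0: "(\<integral>\<omega>. indicator A \<omega> * (R \<omega> - expectation R) \<partial>M) = 0" .
    have int: "integrable M (\<lambda>\<omega>. indicator A \<omega> * Q \<omega>)" if "integrable M Q" for Q :: "'a \<Rightarrow> real"
      using integrable_mult_indicator[OF \<open>A \<in> sets M\<close> that] by simp
    have "(\<integral>\<omega>. indicator A \<omega> * (h (X \<omega>) + R \<omega>) \<partial>M) - (\<integral>\<omega>. indicator A \<omega> * (h (X \<omega>) + expectation R) \<partial>M)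
        = (\<integral>\<omega>. indicator A \<omega> * (h (X \<omega>) + R \<omega>) - indicator A \<omega> * (h (X \<omega>) + expectation R) \<partial>M)"
      by (rule Bochner_Integration.integral_diff[symmetric]; rule int) (use ih in auto)
    also have "\<dots> = (\<integral>\<omega>. indicator A \<omega> * (R \<omega> - expectation R) \<partial>M)"
      by (rule Bochner_Integration.integral_cong) (auto simp: algebra_simps)
    finally show "(\<integral>\<omega>\<in>A. (h (X \<omega>) + R \<omega>) \<partial>M) = (\<integral>\<omega>\<in>A. (h (X \<omega>) + expectation R) \<partial>M)"
      using 0 by (simp add: set_lebesgue_integral_def)
  qed (use ih in auto)
qed

end

section \<open>Gradients\<close>

lemma gradient_eqI:
  assumes "GDERIV f x :> D"
  shows "gradient f x = D"
  unfolding gradient_def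
proof (rule the_equality)
  show "GDERIV f x :> D" by fact
next
  fix E assume "GDERIV f x :> E"
  then have "(\<lambda>h. h \<bullet> E) = (\<lambda>h. h \<bullet> D)"
    using assms unfolding gderiv_def by (rule has_derivative_unique)
  then show "E = D" by (metis inner_commute vector_eq_rdot)
qed

lemma GDERIV_gradient:
  fixes f :: "'x::euclidean_space \<Rightarrow> real"
  assumes "f differentiable (at x)"
  shows "GDERIV f x :> gradient f x"
proof -
  obtain D where D: "(f has_derivative D) (at x)"
    using assms by (auto simp: differentiable_def)
  interpret bounded_linear D using D by (rule has_derivative_bounded_linear)
  have "D h = h \<bullet> (\<Sum>i\<in>Basis. D i *\<^sub>R i)" for h
  proof -
    have "D h = D (\<Sum>i\<in>Basis. (h \<bullet> i) *\<^sub>R i)" by (simp only: euclidean_representation)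
    then show ?thesis by (simp add: sum scale inner_sum_right mult.commute)
  qed
  then have "D = (\<lambda>h. h \<bullet> (\<Sum>i\<in>Basis. D i *\<^sub>R i))" by blast
  then have "GDERIV f x :> (\<Sum>i\<in>Basis. D i *\<^sub>R i)" using D by (simp add: gderiv_def)
  then show ?thesis using gradient_eqI by metis
qed

lemma gradient_sum:
  fixes f :: "'k \<Rightarrow> 'x::euclidean_space \<Rightarrow> real"
  assumes "\<And>k. k \<in> A \<Longrightarrow> f k differentiable (at x)"
  shows "gradient (\<lambda>y. \<Sum>k\<in>A. a k * f k y) x = (\<Sum>k\<in>A. a k *\<^sub>R gradient (f k) x)"
proof (rule gradient_eqI)
  have "((\<lambda>y. \<Sum>k\<in>A. a k * f k y) has_derivative (\<lambda>h. \<Sum>k\<in>A. a k * (h \<bullet> gradient (f k) x))) (at x)"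
    by (intro has_derivative_sum has_derivative_mult_right)
       (use GDERIV_gradient assms in \<open>auto simp: gderiv_def\<close>)
  then show "GDERIV (\<lambda>y. \<Sum>k\<in>A. a k * f k y) x :> (\<Sum>k\<in>A. a k *\<^sub>R gradient (f k) x)"
    by (simp add: gderiv_def inner_sum_right)
qed

lemma gradient_difference_quotient:
  fixes f :: "'x::euclidean_space \<Rightarrow> real"
  assumes "f differentiable (at x)"
  shows "(\<lambda>n. real (Suc n) * (f (x + (1 / real (Suc n)) *\<^sub>R v) - f x)) \<longlonglongrightarrow> gradient f x \<bullet> v"
proof -
  have "((\<lambda>t. x + t *\<^sub>R v) has_derivative (\<lambda>t. t *\<^sub>R v)) (at 0)"
    by (auto intro!: derivative_eq_intros)
  moreover have "(f has_derivative (\<lambda>h. h \<bullet> gradient f x)) (at (x + 0 *\<^sub>R v))"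
    using GDERIV_gradient[OF assms] by (simp add: gderiv_def)
  ultimately have "((\<lambda>t. f (x + t *\<^sub>R v)) has_derivative (\<lambda>t. (t *\<^sub>R v) \<bullet> gradient f x)) (at 0)"
    by (rule has_derivative_compose)
  then have "((\<lambda>t. f (x + t *\<^sub>R v)) has_real_derivative gradient f x \<bullet> v) (at 0)"
    by (simp add: has_field_derivative_def mult_commute_abs inner_commute)
  then have lim: "((\<lambda>h. (f (x + h *\<^sub>R v) - f x) / h) \<longlongrightarrow> gradient f x \<bullet> v) (at 0)"
    by (simp add: DERIV_def)
  have "filterlim (\<lambda>n. 1 / real (Suc n)) (at 0) sequentially"
    using LIMSEQ_inverse_real_of_nat by (intro filterlim_atI) (auto simp: inverse_eq_divide)
  from filterlim_compose[OF lim this] show ?thesis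
    by (simp add: mult.commute)
qed

section \<open>Systems of jointly Gaussian random functions\<close>

definition weighted_sum :: "('k \<Rightarrow> 'x \<Rightarrow> 'o \<Rightarrow> real) \<Rightarrow> ('k \<Rightarrow> real) \<Rightarrow> 'k set \<Rightarrow> 'x \<Rightarrow> 'o \<Rightarrow> real" where
  "weighted_sum F a A x \<omega> = (\<Sum>k\<in>A. a k * F k x \<omega>)"

text \<open>The finite linear combinations of all the values \<open>F k x\<close>: the space whose members joint
  Gaussianity declares to be normal.\<close>

definition lin_comb :: "('k \<Rightarrow> 'x \<Rightarrow> 'o \<Rightarrow> real) \<Rightarrow> ('o \<Rightarrow> real) \<Rightarrow> bool" where
  "lin_comb F X \<longleftrightarrow>
     (\<exists>S c. finite S \<and> X = (\<lambda>\<omega>. \<Sum>i\<in>S. c i * (case i of (k, x) \<Rightarrow> F k x) \<omega>))"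

lemma lin_comb_zero: "lin_comb F (\<lambda>_. 0)"
  unfolding lin_comb_def by (rule exI[of _ "{}"]) simp

lemma lin_comb_single: "lin_comb F (F k x)"
  unfolding lin_comb_def by (intro exI[of _ "{(k, x)}"] exI[of _ "\<lambda>_. 1"]) simp

lemma lin_comb_scale:
  assumes "lin_comb F X"
  shows "lin_comb F (\<lambda>\<omega>. r * X \<omega>)"
proof -
  obtain S c where "finite S" "X = (\<lambda>\<omega>. \<Sum>i\<in>S. c i * (case i of (k, x) \<Rightarrow> F k x) \<omega>)"
    using assms by (auto simp: lin_comb_def)
  then show ?thesis unfolding lin_comb_def
    by (intro exI[of _ S] exI[of _ "\<lambda>i. r * c i"]) (simp add: sum_distrib_left mult.assoc)
qed

lemma lin_comb_add:
  assumes "lin_comb F X" "lin_comb F Y"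
  shows "lin_comb F (\<lambda>\<omega>. X \<omega> + Y \<omega>)"
proof -
  let ?F = "\<lambda>i. case i of (k, x) \<Rightarrow> F k x"
  obtain S c where S: "finite S" "X = (\<lambda>\<omega>. \<Sum>i\<in>S. c i * ?F i \<omega>)"
    using assms by (auto simp: lin_comb_def)
  obtain T d where T: "finite T" "Y = (\<lambda>\<omega>. \<Sum>i\<in>T. d i * ?F i \<omega>)"
    using assms by (auto simp: lin_comb_def)
  have ext: "(\<Sum>i\<in>A. e i * ?F i \<omega>) = (\<Sum>i\<in>S \<union> T. (if i \<in> A then e i else 0) * ?F i \<omega>)"
    if "A \<subseteq> S \<union> T" for A e \<omega>
    using S T that by (intro sum.mono_neutral_cong_left) auto
  have "X \<omega> + Y \<omega> = (\<Sum>i\<in>S \<union> T. ((if i \<in> S then c i else 0) + (if i \<in> T then d i else 0)) * ?F i \<omega>)" for \<omega>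
    unfolding S(2) T(2) by (subst (1 2) ext) (auto simp only: sum.distrib[symmetric] distrib_right Un_upper1 Un_upper2)
  then show ?thesis unfolding lin_comb_def
    using S T by (intro exI[of _ "S \<union> T"] exI[of _ "\<lambda>i. (if i \<in> S then c i else 0) + (if i \<in> T then d i else 0)"]) auto
qed

lemma lin_comb_weighted_sum: "lin_comb F (weighted_sum F a A x)"
proof (induction A rule: infinite_finite_induct)
  case (insert k A)
  have "weighted_sum F a (insert k A) x = (\<lambda>\<omega>. a k * F k x \<omega> + weighted_sum F a A x \<omega>)"
    using insert.hyps by (simp add: weighted_sum_def fun_eq_iff)
  then show ?case
    using lin_comb_add[OF lin_comb_scale[OF lin_comb_single] insert.IH] by simp
qed (simp_all add: weighted_sum_def[abs_def] lin_comb_zero)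

text \<open>The cost and all errors are members of one indexed system, so that the cost and the batch loss
  are both weighted sums in it and one bilinear computation serves every covariance.\<close>

locale gaussian_system = prob_space M
  for M :: "'o measure" +
  fixes F :: "'k \<Rightarrow> 'x::euclidean_space \<Rightarrow> 'o \<Rightarrow> real" and m :: "'k \<Rightarrow> real"
  assumes jointly: "jointly_gaussian M F"
    and mean: "expectation (F k x) = m k"
    and differentiable: "differentiable_random_function M (F k)"
    and derivatives: "covariances_of_derivatives M (F k) (F l)"
begin

lemma lin_comb_normal: "lin_comb F X \<Longrightarrow> normal_rv M X"
  using jointly unfolding lin_comb_def jointly_gaussian_def gaussian_family_def by auto

lemma lin_comb_square_integrable: "lin_comb F X \<Longrightarrow> square_integrable M X"
  by (intro normal_rv_square_integrable lin_comb_normal)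

lemma square_integrable_F: "square_integrable M (F k x)"
  by (intro lin_comb_square_integrable lin_comb_single)

lemma weighted_sum_mean: "expectation (weighted_sum F a A x) = (\<Sum>k\<in>A. a k * m k)"
  using square_integrable_integrable[OF square_integrable_F]
  by (simp add: weighted_sum_def[abs_def] mean)

lemma differentiable_at: "\<omega> \<in> space M \<Longrightarrow> (\<lambda>y. F k y \<omega>) differentiable (at x)"
  using differentiable by (simp add: differentiable_random_function_def)

lemma random_gradient_weighted_sum:
  assumes "\<omega> \<in> space M"
  shows "random_gradient (weighted_sum F a A) x \<omega> = (\<Sum>k\<in>A. a k *\<^sub>R random_gradient (F k) x \<omega>)"
  unfolding random_gradient_def weighted_sum_def
  by (rule gradient_sum) (rule differentiable_at[OF assms])

lemma differentiable_weighted_sum: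
  assumes "\<omega> \<in> space M"
  shows "(\<lambda>y. weighted_sum F a A y \<omega>) differentiable (at x)"
  unfolding weighted_sum_def
  by (cases "finite A") (auto intro!: differentiable_sum differentiable_mult differentiable_at assms)

text \<open>Adding a difference quotient of a weighted sum to a linear combination \<open>X\<close> gives again a
  linear combination, with the mean of \<open>X\<close> because the means of the \<open>F k\<close> do not depend on the
  point. The derivative is reached in the limit.\<close>

lemma normal_add_derivative:
  assumes X: "lin_comb F X"
  shows "normal_rv M (\<lambda>\<omega>. X \<omega> + random_gradient (weighted_sum F a A) y \<omega> \<bullet> v)"
    and "expectation (\<lambda>\<omega>. X \<omega> + random_gradient (weighted_sum F a A) y \<omega> \<bullet> v) = expectation X"
proof -
  let ?L = "weighted_sum F a A"
  define D where "D n \<omega> = X \<omega> + real (Suc n) * (?L (y + (1 / real (Suc n)) *\<^sub>R v) \<omega> + (-1) * ?L y \<omega>)" for n \<omega>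
  have "lin_comb F (D n)" for n
    unfolding D_def by (intro lin_comb_add lin_comb_scale lin_comb_weighted_sum X)
  then have normal: "normal_rv M (D n)" for n by (rule lin_comb_normal)
  have [simp]: "integrable M (?L x)" "integrable M X" for x
    by (intro square_integrable_integrable lin_comb_square_integrable lin_comb_weighted_sum X)+
  have mean: "expectation (D n) = expectation X" for n
    unfolding D_def by (simp add: weighted_sum_mean)
  have lim: "(\<lambda>n. D n \<omega>) \<longlonglongrightarrow> X \<omega> + random_gradient ?L y \<omega> \<bullet> v" if "\<omega> \<in> space M" for \<omega>
    unfolding D_def random_gradient_def
    using gradient_difference_quotient[OF differentiable_weighted_sum[OF that, of a A y], of v]
    by (intro tendsto_add) auto
  show "normal_rv M (\<lambda>\<omega>. X \<omega> + random_gradient ?L y \<omega> \<bullet> v)"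
    "expectation (\<lambda>\<omega>. X \<omega> + random_gradient ?L y \<omega> \<bullet> v) = expectation X"
    using normal_rv_limit[OF normal mean lim] by auto
qed

lemma square_integrable_derivative_weighted_sum:
  "square_integrable M (\<lambda>\<omega>. random_gradient (weighted_sum F a A) y \<omega> \<bullet> v)"
  using normal_add_derivative(1)[OF lin_comb_zero, of a A y v]
  by (simp add: normal_rv_square_integrable)

lemma expectation_derivative_weighted_sum:
  "expectation (\<lambda>\<omega>. random_gradient (weighted_sum F a A) y \<omega> \<bullet> v) = 0"
  using normal_add_derivative(2)[OF lin_comb_zero, of a A y v] by simp

lemma weighted_sum_single: "weighted_sum F (\<lambda>_. 1) {k} = F k"
  by (simp add: weighted_sum_def fun_eq_iff)

lemma square_integrable_derivative:
  "square_integrable M (\<lambda>\<omega>. random_gradient (F k) y \<omega> \<bullet> v)"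
  using square_integrable_derivative_weighted_sum[of "\<lambda>_. 1" "{k}"] by (simp add: weighted_sum_single)

lemma covariance_weighted_sum:
  assumes "finite A" "finite B"
  shows "covariance M (weighted_sum F a A x) (weighted_sum F c B y)
    = (\<Sum>k\<in>A. \<Sum>l\<in>B. a k * c l * covariance M (F k x) (F l y))"
  unfolding weighted_sum_def[abs_def]
  by (rule covariance_sum) (auto intro: assms square_integrable_F)

text \<open>Both sides of the defining identities are bilinear in the two random functions.\<close>

lemma derivatives_weighted_sum:
  assumes AB: "finite A" "finite B"
  shows "covariances_of_derivatives M (weighted_sum F a A) (weighted_sum F c B)"
proof -
  have 1: "covariance M (weighted_sum F a A x) (\<lambda>\<omega>. random_gradient (weighted_sum F c B) y \<omega> \<bullet> v)
      = (\<Sum>k\<in>A. \<Sum>l\<in>B. a k * c l * covariance M (F k x) (\<lambda>\<omega>. random_gradient (F l) y \<omega> \<bullet> v))" for x y v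
  proof -
    have "covariance M (weighted_sum F a A x) (\<lambda>\<omega>. random_gradient (weighted_sum F c B) y \<omega> \<bullet> v)
        = covariance M (\<lambda>\<omega>. \<Sum>k\<in>A. a k * F k x \<omega>) (\<lambda>\<omega>. \<Sum>l\<in>B. c l * (random_gradient (F l) y \<omega> \<bullet> v))"
      by (rule covariance_cong) (simp_all add: weighted_sum_def random_gradient_weighted_sum inner_sum_left)
    also have "\<dots> = (\<Sum>k\<in>A. \<Sum>l\<in>B. a k * c l * covariance M (F k x) (\<lambda>\<omega>. random_gradient (F l) y \<omega> \<bullet> v))"
      by (rule covariance_sum) (auto intro: AB square_integrable_F square_integrable_derivative)
    finally show ?thesis .
  qed
  have 2: "covariance M (\<lambda>\<omega>. random_gradient (weighted_sum F a A) x \<omega> \<bullet> u) (\<lambda>\<omega>. random_gradient (weighted_sum F c B) y \<omega> \<bullet> v)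
      = (\<Sum>k\<in>A. \<Sum>l\<in>B. a k * c l *
          covariance M (\<lambda>\<omega>. random_gradient (F k) x \<omega> \<bullet> u) (\<lambda>\<omega>. random_gradient (F l) y \<omega> \<bullet> v))" for x u y v
  proof -
    have "covariance M (\<lambda>\<omega>. random_gradient (weighted_sum F a A) x \<omega> \<bullet> u) (\<lambda>\<omega>. random_gradient (weighted_sum F c B) y \<omega> \<bullet> v)
        = covariance M (\<lambda>\<omega>. \<Sum>k\<in>A. a k * (random_gradient (F k) x \<omega> \<bullet> u))
            (\<lambda>\<omega>. \<Sum>l\<in>B. c l * (random_gradient (F l) y \<omega> \<bullet> v))"
      by (rule covariance_cong) (simp_all add: random_gradient_weighted_sum inner_sum_left)
    also have "\<dots> = (\<Sum>k\<in>A. \<Sum>l\<in>B. a k * c l *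
        covariance M (\<lambda>\<omega>. random_gradient (F k) x \<omega> \<bullet> u) (\<lambda>\<omega>. random_gradient (F l) y \<omega> \<bullet> v))"
      by (rule covariance_sum) (auto intro: AB square_integrable_derivative)
    finally show ?thesis .
  qed
  show ?thesis
    unfolding covariances_of_derivatives_def 1 2 covariance_weighted_sum[OF AB]
    using derivatives unfolding covariances_of_derivatives_def
    by (auto intro!: DERIV_sum DERIV_cmult)
qed

end

section \<open>Isotropic kernels\<close>

text \<open>The chain rule for \<open>K\<close> along the line \<open>y + t v\<close>. At \<open>x = y\<close> the derivative of \<open>K\<close> is one-sided,
  which suffices because \<open>|x - y - t v|\<^sup>2/2\<close> takes only nonnegative values.\<close>

lemma isotropic_covariance_derivative:
  assumes cov: "\<And>x y. covariance M (f x) (g y) = K ((norm (x - y))\<^sup>2 / 2)"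
    and derivs: "covariances_of_derivatives M f g"
    and K: "\<And>r. r \<ge> 0 \<Longrightarrow> (K has_real_derivative K' r) (at r within {0..})"
  shows "covariance M (f x) (\<lambda>\<omega>. random_gradient g y \<omega> \<bullet> v) = - K' ((norm (x - y))\<^sup>2 / 2) * ((x - y) \<bullet> v)"
proof -
  define p where "p t = (norm (x - (y + t *\<^sub>R v)))\<^sup>2 / 2" for t
  have p: "p t = (norm (x - y))\<^sup>2 / 2 - t * ((x - y) \<bullet> v) + t\<^sup>2 * (v \<bullet> v) / 2" for t
    unfolding p_def power2_norm_eq_inner
    by (simp add: inner_diff_left inner_diff_right inner_add_left inner_add_right inner_commute
        field_simps power2_eq_square)
  have dp: "(p has_real_derivative - ((x - y) \<bullet> v)) (at 0)"
    unfolding p[abs_def] by (auto intro!: derivative_eq_intros)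
  have "(K has_real_derivative K' (p 0)) (at (p 0) within {0..})"
    by (rule K) (simp add: p_def)
  then have "(K has_real_derivative K' (p 0)) (at (p 0) within range p)"
    by (rule DERIV_subset) (auto simp: p_def)
  from DERIV_image_chain[OF this dp] have "((\<lambda>t. K (p t)) has_real_derivative - K' (p 0) * ((x - y) \<bullet> v)) (at 0)"
    by (simp add: o_def)
  moreover have "((\<lambda>t. K (p t)) has_real_derivative covariance M (f x) (\<lambda>\<omega>. random_gradient g y \<omega> \<bullet> v)) (at 0)"
    using derivs unfolding covariances_of_derivatives_def cov p_def by blast
  ultimately show ?thesis using DERIV_unique by (fastforce simp: p_def)
qed

text \<open>Along a line through the origin, the covariance of a value and a derivative is, up to sign,
  \<open>q(s) = K'(s\<^sup>2/2) s\<close>, and it is differentiable by assumption. This makes \<open>K'\<close> continuous away from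
  \<open>0\<close> and gives it the limit \<open>q'(0)\<close> at \<open>0\<close>. The limit agrees with the one-sided derivative \<open>K'(0)\<close>
  by l'Hopital's rule, since a derivative has no jumps.\<close>

lemma isotropic_kernel_derivative_continuous:
  fixes f :: "'x::euclidean_space \<Rightarrow> 'o \<Rightarrow> real"
  assumes cov: "\<And>x y. covariance M (f x) (f y) = K ((norm (x - y))\<^sup>2 / 2)"
    and derivs: "covariances_of_derivatives M f f"
    and K: "\<And>r. r \<ge> 0 \<Longrightarrow> (K has_real_derivative K' r) (at r within {0..})"
  shows "continuous_on {0..} K'"
proof -
  obtain e :: 'x where e: "norm e = 1" using vector_choose_size[of 1] by auto
  define q where "q s = K' (s\<^sup>2 / 2) * s" for s
  have q: "covariance M (f (s *\<^sub>R e)) (\<lambda>\<omega>. random_gradient f 0 \<omega> \<bullet> e) = - q s" for s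
    using isotropic_covariance_derivative[OF cov derivs K, of "s *\<^sub>R e" 0 e] e
    by (simp add: q_def dot_square_norm)
  have "\<exists>D. (q has_real_derivative D) (at s)" for s
  proof -
    have "\<exists>D. ((\<lambda>t. - q (t + s)) has_real_derivative D) (at 0)"
    proof -
      have "((\<lambda>t. covariance M (f (s *\<^sub>R e + t *\<^sub>R e)) (\<lambda>\<omega>. random_gradient f 0 \<omega> \<bullet> e)) has_real_derivative
          covariance M (\<lambda>\<omega>. random_gradient f (s *\<^sub>R e) \<omega> \<bullet> e) (\<lambda>\<omega>. random_gradient f 0 \<omega> \<bullet> e)) (at 0)"
        using derivs unfolding covariances_of_derivatives_def by blast
      moreover have "covariance M (f (s *\<^sub>R e + t *\<^sub>R e)) (\<lambda>\<omega>. random_gradient f 0 \<omega> \<bullet> e) = - q (t + s)" for t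
        using q[of "t + s"] by (simp add: scaleR_add_left add.commute)
      ultimately show ?thesis by (auto simp only:)
    qed
    then obtain D where "((\<lambda>t. - q (t + s)) has_real_derivative D) (at 0)" by blast
    then have "((\<lambda>t. q (t + s)) has_real_derivative - D) (at 0)"
      using DERIV_minus by fastforce
    then show ?thesis using DERIV_shift[of q "-D" 0 s] by auto
  qed
  then obtain D where D: "\<And>s. (q has_real_derivative D s) (at s)" by metis
  have q_sqrt: "K' r = q (sqrt (2 * r)) / sqrt (2 * r)" if "r > 0" for r
    using that by (simp add: q_def)
  have pos: "isCont K' r" if "r > 0" for r
  proof -
    have "isCont (\<lambda>r. q (sqrt (2 * r))) r"
      by (rule isCont_o2[OF _ DERIV_isCont[OF D]]) (intro continuous_intros)
    then have c: "isCont (\<lambda>r. q (sqrt (2 * r)) / sqrt (2 * r)) r"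
      using that by (intro continuous_divide continuous_intros) auto
    have ev: "eventually (\<lambda>r. q (sqrt (2 * r)) / sqrt (2 * r) = K' r) (nhds r)"
    proof -
      have "eventually (\<lambda>r. r \<in> {0<..}) (nhds r)"
        by (rule eventually_nhds_in_open) (use that in auto)
      then show ?thesis by (rule eventually_mono) (simp add: q_sqrt)
    qed
    show ?thesis using c isCont_cong[OF ev] by blast
  qed
  have q0: "((\<lambda>s. q s / s) \<longlongrightarrow> D 0) (at_right 0)"
    using D[of 0] unfolding DERIV_def by (auto simp: q_def intro: tendsto_within_subset)
  have sq: "filterlim (\<lambda>r. sqrt (2 * r)) (at_right 0) (at_right 0)"
    unfolding filterlim_at
  proof
    show "eventually (\<lambda>r. sqrt (2 * r) \<in> {0<..} \<and> sqrt (2 * r) \<noteq> 0) (at_right (0::real))"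
      by (rule eventually_mono[OF eventually_at_right_less[of 0]]) simp
    show "((\<lambda>r. sqrt (2 * r)) \<longlongrightarrow> 0) (at_right 0)"
      using tendsto_real_sqrt[OF tendsto_mult[OF tendsto_const[of 2] tendsto_ident_at[of 0 "{0<..}"]]] by simp
  qed
  have "((\<lambda>r. q (sqrt (2 * r)) / sqrt (2 * r)) \<longlongrightarrow> D 0) (at_right 0)"
    using filterlim_compose[OF q0 sq] .
  then have K'D: "(K' \<longlongrightarrow> D 0) (at_right 0)"
    by (rule Lim_transform_eventually)
       (rule eventually_mono[OF eventually_at_right_less[of 0]], simp add: q_sqrt)
  have K0: "((\<lambda>r. (K r - K 0) / r) \<longlongrightarrow> K' 0) (at_right 0)"
    using K[of 0] by (auto simp: has_field_derivative_iff intro: tendsto_within_subset)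
  have "((\<lambda>r. (K r - K 0) / r) \<longlongrightarrow> D 0) (at_right 0)"
  proof (rule lhopital_right_0[where f' = K' and g' = "\<lambda>_. 1"])
    have "((\<lambda>r. (K r - K 0) / r * r) \<longlongrightarrow> K' 0 * 0) (at_right 0)"
      by (intro tendsto_mult K0 tendsto_ident_at)
    then have "((\<lambda>r. (K r - K 0) / r * r) \<longlongrightarrow> 0) (at_right 0)" by simp
    then show "((\<lambda>r. K r - K 0) \<longlongrightarrow> 0) (at_right 0)"
      by (rule Lim_transform_eventually) (rule eventually_mono[OF eventually_at_right_less[of 0]], simp)
    have "(K has_real_derivative K' r) (at r)" if "r > 0" for r
      using K[of r] that at_within_interior[of r "{0..}"] by simp
    then show "\<forall>\<^sub>F r in at_right 0. ((\<lambda>r. K r - K 0) has_real_derivative K' r) (at r)"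
      by (intro eventually_mono[OF eventually_at_right_less[of 0]]) (auto intro!: derivative_eq_intros)
  qed (use K'D in \<open>auto intro!: tendsto_ident_at eventually_mono[OF eventually_at_right_less[of 0]]\<close>)
  then have "D 0 = K' 0" using K0 by (rule tendsto_unique[OF trivial_limit_at_right_real])
  then have zero: "continuous (at 0 within {0..}) K'"
    using K'D by (simp add: continuous_within at_within_Ici_at_right)
  show ?thesis
    unfolding continuous_on_eq_continuous_within
  proof
    fix r :: real assume "r \<in> {0..}"
    then show "continuous (at r within {0..}) K'"
      using zero pos[of r] by (cases "r = 0") (auto intro: continuous_at_imp_continuous_at_within)
  qed
qed

text \<open>The difference quotients of the covariance of a value and a derivative are
  \<open>-K'(t\<^sup>2|u|\<^sup>2/2) (u \<bullet> v)\<close>, so continuity of \<open>K'\<close> at \<open>0\<close> identifies their limit.\<close>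

lemma isotropic_gradient_covariance:
  fixes f :: "'x::euclidean_space \<Rightarrow> 'o \<Rightarrow> real"
  assumes cov: "\<And>x y. covariance M (f x) (f y) = K ((norm (x - y))\<^sup>2 / 2)"
    and derivs: "covariances_of_derivatives M f f"
    and K: "\<And>r. r \<ge> 0 \<Longrightarrow> (K has_real_derivative K' r) (at r within {0..})"
  shows "covariance M (\<lambda>\<omega>. random_gradient f x \<omega> \<bullet> u) (\<lambda>\<omega>. random_gradient f x \<omega> \<bullet> v) = - K' 0 * (u \<bullet> v)"
proof -
  let ?c = "covariance M (\<lambda>\<omega>. random_gradient f x \<omega> \<bullet> u) (\<lambda>\<omega>. random_gradient f x \<omega> \<bullet> v)"
  define p where "p t = (norm (t *\<^sub>R u))\<^sup>2 / 2" for t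
  have "covariance M (f (x + t *\<^sub>R u)) (\<lambda>\<omega>. random_gradient f x \<omega> \<bullet> v) = - K' (p t) * (t * (u \<bullet> v))" for t
    using isotropic_covariance_derivative[OF cov derivs K, of "x + t *\<^sub>R u" x v] by (simp add: p_def)
  then have "((\<lambda>t. - K' (p t) * (t * (u \<bullet> v))) has_real_derivative ?c) (at 0)"
    using derivs unfolding covariances_of_derivatives_def by (metis (no_types, lifting) ext)
  then have "((\<lambda>t. (- K' (p t) * (t * (u \<bullet> v))) / t) \<longlongrightarrow> ?c) (at 0)"
    by (simp add: DERIV_def)
  then have 1: "((\<lambda>t. - K' (p t) * (u \<bullet> v)) \<longlongrightarrow> ?c) (at 0)"
    by (rule Lim_transform_eventually) (auto simp: eventually_at_filter)
  have "continuous_on UNIV (\<lambda>t. K' (p t))"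
    by (rule continuous_on_compose2[OF isotropic_kernel_derivative_continuous[OF cov derivs K]])
       (auto simp: p_def intro!: continuous_intros)
  then have "((\<lambda>t. K' (p t)) \<longlongrightarrow> K' (p 0)) (at 0)"
    by (simp add: continuous_on_def)
  then have "((\<lambda>t. - K' (p t) * (u \<bullet> v)) \<longlongrightarrow> - K' (p 0) * (u \<bullet> v)) (at 0)"
    by (intro tendsto_intros)
  then have "?c = - K' (p 0) * (u \<bullet> v)"
    using 1 by (rule tendsto_unique[OF trivial_limit_at, rotated -1])
  then show ?thesis by (simp add: p_def)
qed

section \<open>Regression on the value and the gradient\<close>

context gaussian_system
begin

lemma random_gradient_weighted_sum_measurable:
  "random_gradient (weighted_sum F a A) y \<in> borel_measurable M"
  using square_integrable_derivative_weighted_sum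
  by (subst borel_measurable_euclidean_space) (auto simp: square_integrable_def)

text \<open>The coefficients \<open>\<alpha>\<close> and \<open>\<beta>\<close> are the ones for which the residual
  \<open>R = f(x) - \<alpha> g(w) - \<beta> \<bullet> \<nabla>g(w)\<close> is uncorrelated with \<open>g(w)\<close> and \<open>\<nabla>g(w)\<close>. They decouple because a
  stationary random function is uncorrelated with its gradient at the same point.\<close>

lemma cond_exp_given_value_and_gradient:
  fixes a c :: "'k \<Rightarrow> real" and A B :: "'k set"
  defines "f \<equiv> weighted_sum F a A" and "g \<equiv> weighted_sum F c B"
  assumes fin: "finite A" "finite B"
    and fg: "\<And>x y. covariance M (f x) (g y) = C ((norm (x - y))\<^sup>2 / 2)"
    and gg: "\<And>x y. covariance M (g x) (g y) = K ((norm (x - y))\<^sup>2 / 2)"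
    and C: "\<And>r. r \<ge> 0 \<Longrightarrow> (C has_real_derivative C' r) (at r within {0..})"
    and K: "\<And>r. r \<ge> 0 \<Longrightarrow> (K has_real_derivative K' r) (at r within {0..})"
    and K0: "K 0 \<noteq> 0" "K' 0 \<noteq> 0"
  shows "AE \<omega> in M. real_cond_exp M (observation M g w) (f x) \<omega>
    = expectation (f x) + C ((norm (x - w))\<^sup>2 / 2) / K 0 * (g w \<omega> - expectation (g w))
      + C' ((norm (x - w))\<^sup>2 / 2) / K' 0 * ((x - w) \<bullet> random_gradient g w \<omega>)"
proof -
  define r where "r = (norm (x - w))\<^sup>2 / 2"
  define \<alpha> where "\<alpha> = C r / K 0"
  define \<beta> where "\<beta> = (C' r / K' 0) *\<^sub>R (x - w)"
  let ?G = "random_gradient g w"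
  let ?X = "\<lambda>\<omega>. (g w \<omega>, ?G \<omega>)"
  define R where "R \<omega> = (f x \<omega> + (- \<alpha>) * g w \<omega>) + ?G \<omega> \<bullet> (- \<beta>)" for \<omega>
  have sf: "square_integrable M (f x)" and sg: "square_integrable M (g w)"
    and sG: "square_integrable M (\<lambda>\<omega>. ?G \<omega> \<bullet> v)" for v
    unfolding f_def g_def
    by (intro lin_comb_square_integrable lin_comb_weighted_sum square_integrable_derivative_weighted_sum)+
  have sag: "square_integrable M (\<lambda>\<omega>. s * g w \<omega>)" for s
    by (intro square_integrable_scale sg)
  have sfg: "square_integrable M (\<lambda>\<omega>. f x \<omega> + s * g w \<omega>)" for s
    by (intro square_integrable_add sf sag)
  have dfg: "covariances_of_derivatives M f g" and dgg: "covariances_of_derivatives M g g"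
    unfolding f_def g_def by (intro derivatives_weighted_sum fin)+
  have cfG: "covariance M (f x) (\<lambda>\<omega>. ?G \<omega> \<bullet> v) = - C' r * ((x - w) \<bullet> v)" for v
    unfolding r_def by (rule isotropic_covariance_derivative[OF fg dfg C])
  have cgG: "covariance M (g w) (\<lambda>\<omega>. ?G \<omega> \<bullet> v) = 0" for v
    using isotropic_covariance_derivative[OF gg dgg K, of w w v] by simp
  have cGG: "covariance M (\<lambda>\<omega>. ?G \<omega> \<bullet> u) (\<lambda>\<omega>. ?G \<omega> \<bullet> v) = - K' 0 * (u \<bullet> v)" for u v
    by (rule isotropic_gradient_covariance[OF gg dgg K])
  have covR: "covariance M R Z = covariance M (f x) Z + (- \<alpha>) * covariance M (g w) Z
      + covariance M (\<lambda>\<omega>. ?G \<omega> \<bullet> (- \<beta>)) Z" if "square_integrable M Z" for Z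
    unfolding R_def
    by (simp only: covariance_add_left[OF sfg sG that] covariance_add_left[OF sf sag that]
        covariance_scale_left[OF sg that])
  have Rg: "covariance M R (g w) = 0"
    using K0 by (simp only: covR[OF sg] fg gg covariance_commute[of M "\<lambda>\<omega>. ?G \<omega> \<bullet> _"] cgG)
       (simp add: \<alpha>_def r_def)
  have RG: "covariance M R (\<lambda>\<omega>. ?G \<omega> \<bullet> v) = 0" for v
    using K0 by (simp only: covR[OF sG] cfG cgG cGG) (simp add: \<beta>_def)
  have sR: "square_integrable M R"
    unfolding R_def by (intro square_integrable_add sfg sG)
  have "AE \<omega> in M. real_cond_exp M (vimage_algebra (space M) ?X borel)
      (\<lambda>\<omega>. (case ?X \<omega> of (z, \<gamma>) \<Rightarrow> \<alpha> * z + \<beta> \<bullet> \<gamma>) + R \<omega>) \<omega>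
    = (case ?X \<omega> of (z, \<gamma>) \<Rightarrow> \<alpha> * z + \<beta> \<bullet> \<gamma>) + expectation R"
  proof (rule gaussian_cond_exp)
    show "?X \<in> borel_measurable M"
      using sg random_gradient_weighted_sum_measurable unfolding g_def
      by (auto simp: square_integrable_def intro!: borel_measurable_Pair)
    show "normal_rv M (\<lambda>\<omega>. t * R \<omega> + ?X \<omega> \<bullet> u)" for t and u :: "real \<times> 'x"
    proof -
      have "t * R \<omega> + ?X \<omega> \<bullet> u
          = (t * f x \<omega> + (fst u - t * \<alpha>) * g w \<omega>) + ?G \<omega> \<bullet> (snd u - t *\<^sub>R \<beta>)" for \<omega>
        by (simp add: R_def inner_prod_def inner_diff_right algebra_simps)
      then show ?thesis
        unfolding f_def g_def
        by (simp only:) (intro normal_add_derivative(1) lin_comb_add lin_comb_scale lin_comb_weighted_sum)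
    qed
    show "covariance M R (\<lambda>\<omega>. ?X \<omega> \<bullet> u) = 0" for u :: "real \<times> 'x"
    proof -
      have "covariance M R (\<lambda>\<omega>. ?X \<omega> \<bullet> u)
          = covariance M R (\<lambda>\<omega>. fst u * g w \<omega> + ?G \<omega> \<bullet> snd u)"
        by (rule arg_cong[where f = "covariance M R"]) (auto simp: inner_prod_def fun_eq_iff)
      also have "\<dots> = covariance M R (\<lambda>\<omega>. fst u * g w \<omega>) + covariance M R (\<lambda>\<omega>. ?G \<omega> \<bullet> snd u)"
        by (rule covariance_add_right) (intro sag sG sR)+
      also have "\<dots> = 0"
        using covariance_scale_left[OF sg sR, of "fst u"] Rg RG
        by (simp add: covariance_commute[of M R])
      finally show ?thesis .
    qed
    show "(\<lambda>z. case z of (z, \<gamma>) \<Rightarrow> \<alpha> * z + \<beta> \<bullet> \<gamma>) \<in> borel_measurable borel"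
      by (auto simp: split_beta intro!: borel_measurable_continuous_onI continuous_intros)
    have "square_integrable M (\<lambda>\<omega>. \<alpha> * g w \<omega> + ?G \<omega> \<bullet> \<beta>)"
      by (intro square_integrable_add sag sG)
    then show "integrable M (\<lambda>\<omega>. case ?X \<omega> of (z, \<gamma>) \<Rightarrow> \<alpha> * z + \<beta> \<bullet> \<gamma>)"
      by (simp add: square_integrable_integrable inner_commute)
  qed
  moreover have "(case ?X \<omega> of (z, \<gamma>) \<Rightarrow> \<alpha> * z + \<beta> \<bullet> \<gamma>) + R \<omega> = f x \<omega>" for \<omega>
    by (simp add: R_def inner_commute)
  moreover have "expectation R = expectation (f x) - \<alpha> * expectation (g w)"
  proof -
    have "expectation (\<lambda>\<omega>. ?G \<omega> \<bullet> (- \<beta>)) = 0"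
      unfolding g_def by (rule expectation_derivative_weighted_sum)
    moreover have "expectation R = (expectation (f x) + (- \<alpha>) * expectation (g w))
        + expectation (\<lambda>\<omega>. ?G \<omega> \<bullet> (- \<beta>))"
      unfolding R_def
      by (subst Bochner_Integration.integral_add Bochner_Integration.integral_mult_right_zero,
          (intro square_integrable_integrable sf sag sfg sG)+)+ simp
    ultimately show ?thesis by simp
  qed
  ultimately show ?thesis
    unfolding observation_def by (simp add: algebra_simps flip: r_def) (simp add: \<alpha>_def \<beta>_def algebra_simps)
qed

end

text \<open>Two versions agree almost surely on a countable dense set of \<open>d\<close>, and then everywhere by
  continuity.\<close>

lemma continuous_cond_exp_unique:
  fixes Z Z' :: "'x::second_countable_topology \<Rightarrow> 'o \<Rightarrow> real"
  assumes Z: "continuous_cond_exp M F Y Z" and Z': "continuous_cond_exp M F Y Z'"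
  shows "AE \<omega> in M. \<forall>d. Z d \<omega> = Z' d \<omega>"
proof -
  obtain D :: "'x set" where D: "countable D" "\<And>X. open X \<Longrightarrow> X \<noteq> {} \<Longrightarrow> \<exists>d\<in>D. d \<in> X"
    by (rule countable_dense_setE) blast
  have "AE \<omega> in M. Z d \<omega> = Z' d \<omega>" for d
  proof -
    have "AE \<omega> in M. Z d \<omega> = real_cond_exp M F (Y d) \<omega>" "AE \<omega> in M. Z' d \<omega> = real_cond_exp M F (Y d) \<omega>"
      using Z Z' by (auto simp: continuous_cond_exp_def)
    then show ?thesis by eventually_elim simp
  qed
  then have "AE \<omega> in M. \<forall>d\<in>D. Z d \<omega> = Z' d \<omega>"
    using D(1) by (simp add: AE_ball_countable)
  then show ?thesis
  proof (rule AE_mp[OF _ AE_I2], safe)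
    fix \<omega> d assume \<omega>: "\<omega> \<in> space M" and eq: "\<forall>d\<in>D. Z d \<omega> = Z' d \<omega>"
    have "closed {d. Z d \<omega> = Z' d \<omega>}"
      using Z Z' \<omega> by (intro closed_Collect_eq) (auto simp: continuous_cond_exp_def)
    then have "open (- {d. Z d \<omega> = Z' d \<omega>})" by (simp add: open_Compl)
    with D(2)[of "- {d. Z d \<omega> = Z' d \<omega>}"] eq show "Z d \<omega> = Z' d \<omega>" by blast
  qed
qed

section \<open>Minimization along the gradient direction\<close>

text \<open>On a sphere \<open>|d| = r\<close> the function \<open>H\<close> is affine in \<open>d \<bullet> e\<close>, so by Cauchy-Schwarz it is at least
  its value at one of the poles \<open>r e\<close> and \<open>-r e\<close>, with equality only at that pole unless the slope
  \<open>q\<close> vanishes. If \<open>q\<close> vanishes at a minimizer, then both poles minimize and uniqueness forces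
  \<open>r = 0\<close>.\<close>

lemma radial_arg_min:
  fixes e :: "'x::real_inner" and p q :: "real \<Rightarrow> real"
  defines "\<phi> \<equiv> \<lambda>\<eta>. p (\<eta>\<^sup>2 / 2) + \<eta> * q (\<eta>\<^sup>2 / 2)"
    and "H \<equiv> \<lambda>d. p ((norm d)\<^sup>2 / 2) + (d \<bullet> e) * q ((norm d)\<^sup>2 / 2)"
  assumes e: "norm e = 1" and unique: "\<exists>!\<eta>. is_arg_min \<phi> (\<lambda>_. True) \<eta>"
  shows "is_arg_min H (\<lambda>_. True) d \<longleftrightarrow> d = arg_min \<phi> (\<lambda>_. True) *\<^sub>R e"
proof -
  define s where "s = arg_min \<phi> (\<lambda>_. True)"
  have "is_arg_min \<phi> (\<lambda>_. True) s"
    unfolding s_def arg_min_def using unique by (metis someI_ex)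
  then have s_le: "\<phi> s \<le> \<phi> \<eta>" for \<eta> by (simp add: is_arg_min_def not_less)
  have s_uniq: "\<eta> = s" if "\<phi> \<eta> \<le> \<phi> s" for \<eta>
  proof -
    have "is_arg_min \<phi> (\<lambda>_. True) \<eta>" using that s_le by (force simp: is_arg_min_def not_less intro: order_trans)
    then show ?thesis using unique \<open>is_arg_min \<phi> (\<lambda>_. True) s\<close> by blast
  qed
  have ee: "e \<bullet> e = 1" using e by (simp add: dot_square_norm)
  have Hs: "H (\<eta> *\<^sub>R e) = \<phi> \<eta>" for \<eta>
    by (simp add: H_def \<phi>_def e ee power_mult_distrib)
  have ge: "\<exists>\<sigma>. \<sigma>\<^sup>2 = (norm d)\<^sup>2 \<and> \<phi> \<sigma> \<le> H d \<and> (\<phi> \<sigma> = H d \<longrightarrow> q ((norm d)\<^sup>2 / 2) \<noteq> 0 \<longrightarrow> d \<bullet> e = \<sigma>)" for d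
  proof -
    let ?q = "q ((norm d)\<^sup>2 / 2)"
    have de: "\<bar>d \<bullet> e\<bar> \<le> norm d" using Cauchy_Schwarz_ineq2[of d e] e by simp
    \<comment> \<open>the signed radius of the pole with the smaller value\<close>
    define \<sigma> where "\<sigma> = (if ?q \<ge> 0 then - norm d else norm d)"
    have \<sigma>2: "\<sigma>\<^sup>2 = (norm d)\<^sup>2" by (simp add: \<sigma>_def)
    have "0 \<le> (d \<bullet> e - \<sigma>) * ?q"
      using de by (auto simp: \<sigma>_def intro!: mult_nonneg_nonneg mult_nonpos_nonpos)
    moreover have "H d - \<phi> \<sigma> = (d \<bullet> e - \<sigma>) * ?q"
      by (simp add: H_def \<phi>_def \<sigma>2 algebra_simps)
    ultimately show ?thesis using \<sigma>2 by (intro exI[of _ \<sigma>]) auto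
  qed
  show ?thesis
    unfolding s_def[symmetric]
  proof
    assume "is_arg_min H (\<lambda>_. True) d"
    then have "H d \<le> \<phi> s" using Hs[of s] by (metis is_arg_min_def not_less)
    moreover obtain \<sigma> where \<sigma>: "\<sigma>\<^sup>2 = (norm d)\<^sup>2" "\<phi> \<sigma> \<le> H d"
      "\<phi> \<sigma> = H d \<Longrightarrow> q ((norm d)\<^sup>2 / 2) \<noteq> 0 \<Longrightarrow> d \<bullet> e = \<sigma>"
      using ge[of d] by blast
    ultimately have eq: "\<phi> \<sigma> = H d" "\<phi> s = H d" "\<sigma> = s"
      using s_le[of \<sigma>] s_uniq[of \<sigma>] by auto
    have "d \<bullet> e = s"
    proof (cases "q ((norm d)\<^sup>2 / 2) = 0")
      case True
      then have "\<phi> (norm d) = H d" "\<phi> (- norm d) = H d"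
        by (simp_all add: \<phi>_def H_def)
      then have "norm d = s" "- norm d = s" using eq s_uniq by auto
      then show ?thesis by auto
    qed (use \<sigma> eq in auto)
    then have "(norm (d - s *\<^sub>R e))\<^sup>2 = 0"
      using \<sigma>(1) eq(3) ee unfolding power2_norm_eq_inner
      by (simp add: inner_diff_left inner_diff_right inner_commute power2_eq_square)
    then show "d = s *\<^sub>R e" by simp
  next
    assume d: "d = s *\<^sub>R e"
    have "H d \<le> H d'" for d'
      using ge[of d'] s_le Hs[of s] d by (metis order_trans)
    then show "is_arg_min H (\<lambda>_. True) d" by (simp add: is_arg_min_def not_less)
  qed
qed

section \<open>The batch loss\<close>

lemma is_arg_min_positive_affine:
  assumes "\<beta> > 0"
  shows "is_arg_min (\<lambda>d. \<alpha> + \<beta> * H d :: real) P d \<longleftrightarrow> is_arg_min H P d"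
  using assms by (simp add: is_arg_min_def)

lemma batch_loss_weighted_sum:
  "batch_loss J eps b = weighted_sum (case_option J eps) (case_option 1 (\<lambda>_. 1 / real b)) (insert None (Some ` {..<b}))"
  by (simp add: batch_loss_def weighted_sum_def fun_eq_iff sum.reindex sum_distrib_left)

text \<open>The regression is \<open>\<mu> + \<beta> H\<close> with \<open>\<beta> = (\<mu> - z) C(0) / k > 0\<close>, where \<open>H\<close> restricts on the line
  spanned by \<open>G\<close> to the RFD objective. The value of \<open>\<Theta>\<close> is dictated by this factorization.\<close>

lemma arg_min_cond_exp:
  fixes G :: "'x::real_inner"
  assumes pos: "C 0 > 0" "k > 0" "k' \<noteq> 0" "C' 0 \<noteq> 0" and z: "z < \<mu>" and G: "G \<noteq> 0"
    and \<Theta>: "\<Theta> = C' 0 / k' * (k / C 0) * (norm G / (\<mu> - z))"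
    and unique: "\<exists>!\<eta>. is_arg_min (rfd_objective C C' \<Theta>) (\<lambda>_. True) \<eta>"
  shows "is_arg_min (\<lambda>d. \<mu> + C ((norm d)\<^sup>2 / 2) / k * (z - \<mu>) + C' ((norm d)\<^sup>2 / 2) / k' * (- d \<bullet> G)) (\<lambda>_. True) d
    \<longleftrightarrow> d = eta_star C C' \<Theta> *\<^sub>R (G /\<^sub>R norm G)"
proof -
  define p q where "p r = - (C r / C 0)" and "q r = - (C' r / C' 0) * \<Theta>" for r
  define \<beta> where "\<beta> = (\<mu> - z) * C 0 / k"
  have \<beta>: "\<beta> > 0" using pos z by (simp add: \<beta>_def)
  have e: "norm (G /\<^sub>R norm G) = 1" using G by simp
  have obj: "rfd_objective C C' \<Theta> = (\<lambda>\<eta>. p (\<eta>\<^sup>2 / 2) + \<eta> * q (\<eta>\<^sup>2 / 2))"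
    by (simp add: rfd_objective_def p_def q_def fun_eq_iff)
  have eq: "\<mu> + C ((norm d)\<^sup>2 / 2) / k * (z - \<mu>) + C' ((norm d)\<^sup>2 / 2) / k' * (- d \<bullet> G)
      = \<mu> + \<beta> * (p ((norm d)\<^sup>2 / 2) + (d \<bullet> (G /\<^sub>R norm G)) * q ((norm d)\<^sup>2 / 2))" for d
  proof -
    have "\<beta> * p r = C r / k * (z - \<mu>)" for r
      using pos by (simp add: \<beta>_def p_def field_simps)
    moreover have "\<beta> * ((d \<bullet> (G /\<^sub>R norm G)) * q r) = C' r / k' * (- d \<bullet> G)" for r
      using pos z G by (simp add: \<beta>_def q_def \<Theta> field_simps)
    ultimately show ?thesis by (simp only: distrib_left)
  qed
  show ?thesis
    unfolding eq is_arg_min_positive_affine[OF \<beta>] eta_star_def obj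
    by (rule radial_arg_min[OF e]) (use unique in \<open>simp only: obj\<close>)
qed

lemma sum_diagonal:
  fixes c h :: "'k \<Rightarrow> real"
  assumes "finite B"
  shows "(\<Sum>k\<in>B. \<Sum>l\<in>B. c k * c l * (if k = l then h k else 0)) = (\<Sum>k\<in>B. (c k)\<^sup>2 * h k)"
  using assms by (simp add: if_distrib power2_eq_square cong: if_cong)

theorem mainTheorem7:
  fixes M :: "'o measure"
    and J :: "real ^ 'n \<Rightarrow> 'o \<Rightarrow> real"
    and eps :: "nat \<Rightarrow> real ^ 'n \<Rightarrow> 'o \<Rightarrow> real"
    and C C' Ce Ce' :: "real \<Rightarrow> real"
    and \<mu> :: real
    and b :: nat
    and w :: "real ^ 'n"
  assumes "prob_space M"
    and "gaussian_random_function M J \<mu> C"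
    and "\<And>i. gaussian_random_function M (eps i) 0 Ce"
    and "prob_space.indep_vars M (\<lambda>_. Pi\<^sub>M UNIV (\<lambda>_::real ^ 'n. (borel :: real measure)))
           (\<lambda>i \<omega> x. eps i x \<omega>) UNIV"
    and "jointly_gaussian M (case_option J eps)"
    and "\<And>i x y. covariance M (J x) (eps i y) = 0"
    and "differentiable_random_function M J"
    and "\<And>i. differentiable_random_function M (eps i)"
    and "\<And>k l. covariances_of_derivatives M (case_option J eps k) (case_option J eps l)"
    and "\<And>r. r \<ge> 0 \<Longrightarrow> (C has_real_derivative C' r) (at r within {0..})"
    and "\<And>r. r \<ge> 0 \<Longrightarrow> (Ce has_real_derivative Ce' r) (at r within {0..})"
    and "C 0 > 0"
    and "C' 0 < 0"
    and "b \<ge> 1"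
  shows "let L = batch_loss J eps b;
             Y = (\<lambda>d. J (w - d));
             F = observation M L w;
             \<Theta> = (\<lambda>\<omega>. C' 0 / (C' 0 + (1 / real b) * Ce' 0)
                      * ((C 0 + (1 / real b) * Ce 0) / C 0)
                      * (norm (random_gradient L w \<omega>) / (\<mu> - L w \<omega>)))
         in (\<exists>Z. continuous_cond_exp M F Y Z) \<and>
            (\<forall>Z. continuous_cond_exp M F Y Z \<longrightarrow>
              (AE \<omega> in M.
                 L w \<omega> < \<mu> \<and> random_gradient L w \<omega> \<noteq> 0 \<and>
                 (\<exists>!\<eta>. is_arg_min (rfd_objective C C' (\<Theta> \<omega>)) (\<lambda>_. True) \<eta>) \<longrightarrow>
                 (\<forall>d. is_arg_min (\<lambda>d. Z d \<omega>) (\<lambda>_. True) d \<longleftrightarrow>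
                      d = eta_star C C' (\<Theta> \<omega>) *\<^sub>R
                          (random_gradient L w \<omega> /\<^sub>R norm (random_gradient L w \<omega>)))))"
proof -
  interpret prob_space M by fact
  let ?F = "case_option J eps" and ?m = "case_option \<mu> (\<lambda>_. 0)"
  let ?A = "{None}" and ?B = "insert None (Some ` {..<b})"
  let ?c = "case_option 1 (\<lambda>_. 1 / real b)"
  interpret gaussian_system M ?F ?m
  proof
    show "jointly_gaussian M ?F" by fact
    show "covariances_of_derivatives M (?F k) (?F l)" for k l by fact
    show "differentiable_random_function M (?F k)" for k
      using assms(7,8) by (cases k) auto
    show "expectation (?F k x) = ?m k" for k x
      using assms(2,3) by (cases k) (auto simp: gaussian_random_function_def)
  qed
  define L where "L = batch_loss J eps b"
  define K where "K r = C r + (1 / real b) * Ce r" for r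
  define K' where "K' r = C' r + (1 / real b) * Ce' r" for r
  have b: "real b > 0" using assms(14) by simp
  have L: "L = weighted_sum ?F ?c ?B"
    unfolding L_def by (rule batch_loss_weighted_sum)
  have J: "J = weighted_sum ?F (\<lambda>_. 1) ?A"
    using weighted_sum_single[of None] by simp
  have eps_indep: "covariance M (eps i x) (eps j y) = 0" if "i \<noteq> j" for i j x y
  proof -
    \<comment> \<open>The random function of index \<open>i\<close> is evaluated at \<open>x\<close> and all the others at \<open>y\<close>.\<close>
    have "indep_vars (\<lambda>_. borel) (\<lambda>k \<omega>. eps k (if k = i then x else y) \<omega>) UNIV"
      by (rule indep_vars_compose2[OF assms(4), of "\<lambda>k h. h (if k = i then x else y)"]) auto
    then have "indep_vars (\<lambda>_. borel) (\<lambda>k \<omega>. eps k (if k = i then x else y) \<omega>) {i, j}"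
      by (rule indep_vars_subset) auto
    then have "expectation (\<lambda>\<omega>. \<Prod>k\<in>{i, j}. eps k (if k = i then x else y) \<omega>)
        = (\<Prod>k\<in>{i, j}. expectation (\<lambda>\<omega>. eps k (if k = i then x else y) \<omega>))"
      by (intro indep_vars_lebesgue_integral)
         (use square_integrable_integrable[OF square_integrable_F[of "Some _"]] in auto)
    then have "expectation (\<lambda>\<omega>. eps i x \<omega> * eps j y \<omega>) = expectation (eps i x) * expectation (eps j y)"
      using that by (simp add: eq_commute)
    then show ?thesis
      using covariance_eq[OF square_integrable_F[of "Some i" x] square_integrable_F[of "Some j" y]] by simp
  qed
  have cov: "covariance M (?F k x) (?F l y)
      = (if k = l then case_option C (\<lambda>_. Ce) k ((norm (x - y))\<^sup>2 / 2) else 0)" for k l x y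
    using assms(2,3,6) eps_indep covariance_commute[of M "eps _ _" "J _"]
    by (cases k; cases l) (auto simp: gaussian_random_function_def)
  have covJL: "covariance M (J x) (L y) = C ((norm (x - y))\<^sup>2 / 2)" for x y
    by (subst J, subst L, subst covariance_weighted_sum)
       (use assms(2,6) in \<open>simp_all add: sum.reindex gaussian_random_function_def\<close>)
  have covLL: "covariance M (L x) (L y) = K ((norm (x - y))\<^sup>2 / 2)" for x y
  proof -
    have "covariance M (L x) (L y)
        = (\<Sum>k\<in>?B. (?c k)\<^sup>2 * case_option C (\<lambda>_. Ce) k ((norm (x - y))\<^sup>2 / 2))"
      unfolding L by (subst covariance_weighted_sum) (simp_all only: cov sum_diagonal finite_insert finite_imageI finite_lessThan)
    also have "\<dots> = K ((norm (x - y))\<^sup>2 / 2)"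
      using b by (simp add: K_def sum.reindex power2_eq_square)
    finally show ?thesis .
  qed
  have dK: "(K has_real_derivative K' r) (at r within {0..})" if "r \<ge> 0" for r
    unfolding K_def K'_def by (intro DERIV_add DERIV_cmult assms(10,11) that)
  have deriv_JJ: "covariances_of_derivatives M J J" and deriv_ee: "covariances_of_derivatives M (eps 0) (eps 0)"
    using assms(9)[of None None] assms(9)[of "Some 0" "Some 0"] by simp_all
  have covJJ: "covariance M (J x) (J y) = C ((norm (x - y))\<^sup>2 / 2)" for x y
    using cov[of None x None y] by simp
  have covee: "covariance M (eps 0 x) (eps 0 y) = Ce ((norm (x - y))\<^sup>2 / 2)" for x y
    using cov[of "Some 0" x "Some 0" y] by simp
  have K0: "K 0 > 0"
  proof -
    have "Ce 0 \<ge> 0" using covee[of 0 0] covariance_self_nonneg[of "eps 0 0"] by simp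
    then show ?thesis using assms(12) b by (simp add: K_def add_pos_nonneg)
  qed
  have K'0: "K' 0 < 0"
  proof -
    obtain u :: "real ^ 'n" where u: "norm u = 1" using vector_choose_size[of 1] by auto
    \<comment> \<open>\<open>-C\<^sub>\<epsilon>'(0)\<close> is the variance of a directional derivative of the error.\<close>
    let ?D = "\<lambda>\<omega>. random_gradient (eps 0) 0 \<omega> \<bullet> u"
    have "covariance M ?D ?D = - Ce' 0 * (u \<bullet> u)"
      by (rule isotropic_gradient_covariance[OF covee deriv_ee assms(11)])
    then have "0 \<le> - Ce' 0 * (u \<bullet> u)"
      using covariance_self_nonneg[of ?D] by simp
    then have "Ce' 0 \<le> 0" using u by (simp add: dot_square_norm)
    then have "(1 / real b) * Ce' 0 \<le> 0" using b by (intro mult_nonneg_nonpos) auto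
    then show ?thesis using assms(13) unfolding K'_def by linarith
  qed
  let ?G = "random_gradient L w" and ?\<F> = "observation M L w"
  define Z where "Z d \<omega> = \<mu> + C ((norm d)\<^sup>2 / 2) / K 0 * (L w \<omega> - \<mu>)
      + C' ((norm d)\<^sup>2 / 2) / K' 0 * (- d \<bullet> ?G \<omega>)" for d \<omega>
  have Z: "continuous_cond_exp M ?\<F> (\<lambda>d. J (w - d)) Z"
    unfolding continuous_cond_exp_def
  proof (intro conjI allI ballI)
    fix d
    have X: "(\<lambda>\<omega>. (L w \<omega>, ?G \<omega>)) \<in> borel_measurable ?\<F>"
      unfolding observation_def by (rule measurable_vimage_algebra1) auto
    have "(\<lambda>(z, \<gamma> :: real ^ 'n). \<mu> + C ((norm d)\<^sup>2 / 2) / K 0 * (z - \<mu>) + C' ((norm d)\<^sup>2 / 2) / K' 0 * (- d \<bullet> \<gamma>))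
        \<in> borel_measurable borel"
      unfolding split_beta by (intro borel_measurable_continuous_onI continuous_intros)
    from measurable_compose[OF X this] show "Z d \<in> borel_measurable ?\<F>"
      by (simp add: Z_def[abs_def])
  next
    fix d
    have EJ: "expectation (J x) = \<mu>" for x
      using assms(2) by (simp add: gaussian_random_function_def)
    have EL: "expectation (L x) = \<mu>" for x
      unfolding L weighted_sum_mean by (simp add: sum.reindex)
    have "AE \<omega> in M. real_cond_exp M ?\<F> (J (w - d)) \<omega> = expectation (J (w - d))
        + C ((norm ((w - d) - w))\<^sup>2 / 2) / K 0 * (L w \<omega> - expectation (L w))
        + C' ((norm ((w - d) - w))\<^sup>2 / 2) / K' 0 * (((w - d) - w) \<bullet> ?G \<omega>)"
      by (rule cond_exp_given_value_and_gradient[where a = "\<lambda>_. 1" and A = ?A and c = ?c and B = ?B,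
            folded J L, OF _ _ covJL covLL assms(10) dK])
         (use K0 K'0 in auto)
    then show "AE \<omega> in M. Z d \<omega> = real_cond_exp M ?\<F> (J (w - d)) \<omega>"
      by eventually_elim (simp add: Z_def EJ EL)
  next
    fix \<omega>
    have "continuous_on {0..} C"
      unfolding continuous_on_eq_continuous_within
      using assms(10) DERIV_continuous by fastforce
    then have "continuous_on UNIV (\<lambda>d :: real ^ 'n. C ((norm d)\<^sup>2 / 2))"
      by (rule continuous_on_compose2) (auto intro!: continuous_intros)
    moreover have "continuous_on UNIV (\<lambda>d :: real ^ 'n. C' ((norm d)\<^sup>2 / 2))"
      by (rule continuous_on_compose2[OF isotropic_kernel_derivative_continuous[OF covJJ deriv_JJ assms(10)]])
         (auto intro!: continuous_intros)
    ultimately show "continuous_on UNIV (\<lambda>d. Z d \<omega>)"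
      unfolding Z_def using K0 K'0 by (intro continuous_intros) auto
  qed
  have minimizers: "AE \<omega> in M. L w \<omega> < \<mu> \<and> ?G \<omega> \<noteq> 0 \<and>
      (\<exists>!\<eta>. is_arg_min (rfd_objective C C' (\<Theta> \<omega>)) (\<lambda>_. True) \<eta>) \<longrightarrow>
      (\<forall>d. is_arg_min (\<lambda>d. Z' d \<omega>) (\<lambda>_. True) d \<longleftrightarrow>
        d = eta_star C C' (\<Theta> \<omega>) *\<^sub>R (?G \<omega> /\<^sub>R norm (?G \<omega>)))"
    if "continuous_cond_exp M ?\<F> (\<lambda>d. J (w - d)) Z'"
      and \<Theta>: "\<And>\<omega>. \<Theta> \<omega> = C' 0 / K' 0 * (K 0 / C 0) * (norm (?G \<omega>) / (\<mu> - L w \<omega>))" for Z' \<Theta>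
    using continuous_cond_exp_unique[OF that(1) Z]
  proof eventually_elim
    case (elim \<omega>)
    then have "(\<lambda>d. Z' d \<omega>) = (\<lambda>d. Z d \<omega>)" by simp
    then show ?case
      unfolding Z_def
      using arg_min_cond_exp[where C = C and C' = C' and k = "K 0" and k' = "K' 0" and \<mu> = \<mu>
          and z = "L w \<omega>" and G = "?G \<omega>", OF assms(12) K0 _ _ _ _ \<Theta>[of \<omega>]]
        assms(13) K'0 by auto
  qed
  show ?thesis
    unfolding Let_def L_def[symmetric] K_def[symmetric] K'_def[symmetric]
    by (intro conjI exI[of _ Z] Z allI impI, rule minimizers) (assumption, rule refl)
qed

end
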